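(* Let $U\in U(2)$, let $\epsilon>0$, and let $n_b$ be a positive integer such that $\|U^{1/2^{n_b-1}}-I\|_{\max}\le\epsilon$. Let $n_c$ be a positive integer and $n=n_c+1$ with $n\ge n_b+8$. Then an approximate decomposition of the $n_c$-controlled gate $C^{n_c}U$, up to error $\epsilon$, can be constructed on the $n$ qubits (no auxiliary qubits) using at most $$4(n_b-1)^2+32n-112$$ CNOT gates (together with single-qubit gates).
   Context: $C^{n_c}U$ denotes the $(n_c+1)$-qubit gate with control qubits $c_1,\dots,c_{n_c}$ and target qubit $t$ that applies $U$ to $t$ when all controls are in state $|1\rangle$ and the identity otherwise. An approximate decomposition up to error $\epsilon$ is a circuit of CNOT and single-qubit gates on these $n_c+1$ qubits such that, for each computational basis state $x$ of the controls, the operator $V_x$ applied to the target satisfies $\|V_x-U\|_{\max}\le\epsilon$ if $x=1\cdots1$ and $\|V_x-I\|_{\max}\le\epsilon$ otherwise. Here $\|M\|_{\max}=\max_{i,j}|M_{ij}|$, and for $U=W\,\mathrm{diag}(e^{i\theta_1},e^{i\theta_2})W^\dagger$ with $W$ unitary and $\theta_j\in(-\pi,\pi]$, $U^{1/N}=W\,\mathrm{diag}(e^{i\theta_1/N},e^{i\theta_2/N})W^\dagger$. *)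

theory Defs
  imports "HOL-Analysis.Analysis" "Jordan_Normal_Form.Matrix"
begin

definition adj :: "complex mat \<Rightarrow> complex mat" where
  "adj A = mat (dim_col A) (dim_row A) (\<lambda>(i,j). cnj (A $$ (j,i)))"

definition is_unitary :: "nat \<Rightarrow> complex mat \<Rightarrow> bool" where
  "is_unitary d A \<longleftrightarrow> A \<in> carrier_mat d d \<and> A * adj A = 1\<^sub>m d \<and> adj A * A = 1\<^sub>m d"

definition max_norm :: "complex mat \<Rightarrow> real" where
  "max_norm A = Max ({cmod (A $$ (i,j)) | i j. i < dim_row A \<and> j < dim_col A} \<union> {0})"

definition diag2 :: "complex \<Rightarrow> complex \<Rightarrow> complex mat" where
  "diag2 a b = mat 2 2 (\<lambda>(i,j). if i = j then (if i = 0 then a else b) else 0)"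

definition mat_root :: "nat \<Rightarrow> complex mat \<Rightarrow> complex mat" where
  "mat_root N U = (SOME R. \<exists>W t1 t2. is_unitary 2 W \<and>
      -pi < t1 \<and> t1 \<le> pi \<and> -pi < t2 \<and> t2 \<le> pi \<and>
      U = W * diag2 (cis t1) (cis t2) * adj W \<and>
      R = W * diag2 (cis (t1 / real N)) (cis (t2 / real N)) * adj W)"

text \<open>Circuits on n qubits numbered 0..n-1. Basis state k < 2^n has
  qubit q in state bit q of k, i.e. k div 2^q mod 2.\<close>
definition qbit :: "nat \<Rightarrow> nat \<Rightarrow> nat" where
  "qbit q k = k div 2 ^ q mod 2"

datatype gate = Single nat "complex mat" | CNOT nat nat  (* CNOT control target *)

definition flip :: "nat \<Rightarrow> nat \<Rightarrow> nat" where
  "flip t k = (if qbit t k = 0 then k + 2 ^ t else k - 2 ^ t)"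

fun gate_wf :: "nat \<Rightarrow> gate \<Rightarrow> bool" where
  "gate_wf n (Single q G) \<longleftrightarrow> q < n \<and> is_unitary 2 G"
| "gate_wf n (CNOT c t) \<longleftrightarrow> c < n \<and> t < n \<and> c \<noteq> t"

fun gate_mat :: "nat \<Rightarrow> gate \<Rightarrow> complex mat" where
  "gate_mat n (Single q G) = mat (2 ^ n) (2 ^ n) (\<lambda>(i,j).
      if (\<forall>r. r \<noteq> q \<longrightarrow> qbit r i = qbit r j) then G $$ (qbit q i, qbit q j) else 0)"
| "gate_mat n (CNOT c t) = mat (2 ^ n) (2 ^ n) (\<lambda>(i,j).
      if i = (if qbit c j = 1 then flip t j else j) then 1 else 0)"

text \<open>A circuit is a list of gates, applied first to last.\<close>
type_synonym circuit = "gate list"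

definition circuit_wf :: "nat \<Rightarrow> circuit \<Rightarrow> bool" where
  "circuit_wf n C \<longleftrightarrow> (\<forall>g \<in> set C. gate_wf n g)"

fun circuit_mat :: "nat \<Rightarrow> circuit \<Rightarrow> complex mat" where
  "circuit_mat n [] = 1\<^sub>m (2 ^ n)"
| "circuit_mat n (g # C) = circuit_mat n C * gate_mat n g"

definition cnot_count :: "circuit \<Rightarrow> nat" where
  "cnot_count C = length (filter (\<lambda>g. case g of CNOT _ _ \<Rightarrow> True | _ \<Rightarrow> False) C)"

text \<open>Controls are qubits 0..nc-1, the target is qubit nc.
  Basis index x + 2^nc * a: control string x < 2^nc, target bit a.
  The circuit acts as |x> (x) |psi> |-> |x> (x) V_x |psi>, where V_x is the 2x2 block.\<close>
definition target_block :: "nat \<Rightarrow> complex mat \<Rightarrow> nat \<Rightarrow> complex mat" where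
  "target_block nc M x = mat 2 2 (\<lambda>(a,b). M $$ (x + 2 ^ nc * a, x + 2 ^ nc * b))"

definition approx_decomposition :: "nat \<Rightarrow> complex mat \<Rightarrow> real \<Rightarrow> circuit \<Rightarrow> bool" where
  "approx_decomposition nc U \<epsilon> C \<longleftrightarrow> circuit_wf (nc + 1) C \<and>
     (let M = circuit_mat (nc + 1) C in
       (\<forall>i < 2 ^ (nc + 1). \<forall>j < 2 ^ (nc + 1). i mod 2 ^ nc \<noteq> j mod 2 ^ nc \<longrightarrow> M $$ (i,j) = 0) \<and>
       (\<forall>x < 2 ^ nc. max_norm (target_block nc M x -
           (if x = 2 ^ nc - 1 then U else 1\<^sub>m 2)) \<le> \<epsilon>))"

end

theory Submission
  imports Defs
begin

text \<open>Diagonalise \<open>U\<close> on the target and view the \<open>nb\<close> highest controls as a binary number \<open>Y\<close>. Let \<open>D\<close>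
  increment \<open>Y\<close> modulo \<open>2 ^ nb\<close> when the other \<open>k = nc - nb\<close> controls are all set, and let \<open>\<Psi>\<close> apply
  the power \<open>h(Y) / 2 ^ (nb - 1)\<close> of \<open>U\<close> with \<open>h(Y) = (Y + 1) div 2\<close>, which is a nonnegative integer
  combination of the digits. The commutator of \<open>\<Psi>\<close> and \<open>D\<close> applies the power
  \<open>(h(Y) - h(D Y)) / 2 ^ (nb - 1)\<close>: this is \<open>U\<close> exactly when all controls are set (the increment
  overflows), and otherwise the identity or the inverse of the root, whose distance to the
  identity is that of the root.

  Conjugation by a quantum Fourier transform (\<open>nb (nb - 1)\<close> CNOTs) turns \<open>D\<close> into a layer of
  simultaneous rotations controlled by \<open>k\<close> qubits. This is a group commutator of two controlled flips
  of the whole register, each with about \<open>k / 2\<close> controls and with the other half as dirty ancillas.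
  Signs depending on the controls alone are harmless, as they cancel between \<open>D\<close> and its inverse;
  this allows controlled flips at \<open>8\<close> CNOTs per control.\<close>

section \<open>Circuits as operators on functions of bit assignments\<close>

text \<open>Amplitudes are indexed by assignments of all natural-number qubits, so an operator does
  not mention the number of qubits and circuit identities become equalities of functions.\<close>

type_synonym oper = "((nat \<Rightarrow> bool) \<Rightarrow> complex) \<Rightarrow> (nat \<Rightarrow> bool) \<Rightarrow> complex"

fun gate_op :: "gate \<Rightarrow> oper" where
  "gate_op (Single q G) f b =
     G $$ (of_bool (b q), 0) * f (b(q := False)) + G $$ (of_bool (b q), 1) * f (b(q := True))"
| "gate_op (CNOT c t) f b = f (if b c then b(t := \<not> b t) else b)"

fun circuit_op :: "circuit \<Rightarrow> oper" where
  "circuit_op [] = id"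
| "circuit_op (g # C) = circuit_op C \<circ> gate_op g"

lemma circuit_op_append: "circuit_op (C @ D) = circuit_op D \<circ> circuit_op C"
  by (induction C) (auto simp: comp_assoc)

lemma qbit_eq_of_bool: "qbit q k = of_bool (bit k q)"
  by (simp add: qbit_def bit_iff_odd mod_2_eq_odd)

lemma flip_eq_flip_bit: "flip t k = flip_bit t k"
proof (cases "bit k t")
  case True
  then have "k = set_bit t (unset_bit t k)"
    by (auto intro: bit_eqI simp: bit_simps)
  also have "\<dots> = unset_bit t k + 2 ^ t"
    by (simp add: set_bit_eq bit_simps)
  finally have "k - 2 ^ t = unset_bit t k" by simp
  then show ?thesis
    using True by (simp add: flip_def qbit_eq_of_bool flip_bit_eq_if)
qed (simp add: flip_def qbit_eq_of_bool flip_bit_eq_if set_bit_eq)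

section \<open>Matrix indices as bit assignments\<close>

lemma bij_betw_bit: "bij_betw bit {..<2 ^ n :: nat} {b. \<forall>q\<ge>n. \<not> b q}"
proof (rule bij_betw_imageI)
  show "inj_on bit {..<2 ^ n :: nat}"
    by (auto intro!: inj_onI bit_eqI)
  have "\<not> bit k q" if "k < 2 ^ n" "n \<le> q" for k q :: nat
    using that by (metis bit_take_bit_iff linorder_not_le take_bit_nat_eq_self)
  moreover have "b \<in> bit ` {..<2 ^ n :: nat}" if "\<forall>q\<ge>n. \<not> b q" for b
  proof
    let ?k = "horner_sum of_bool 2 (map b [0..<n]) :: nat"
    show "b = bit ?k"
    proof
      show "b q = bit ?k q" for q
        using that by (cases "q < n") (auto simp: bit_horner_sum_bit_iff)
    qed
    show "?k \<in> {..<2 ^ n}"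
      using horner_sum_of_bool_2_less[of "map b [0..<n]"] by simp
  qed
  ultimately show "bit ` {..<2 ^ n :: nat} = {b. \<forall>q\<ge>n. \<not> b q}"
    by auto
qed

lemma finite_bit_support: "finite {b. \<forall>q\<ge>n. \<not> (b :: nat \<Rightarrow> bool) q}"
  using bij_betw_finite[OF bij_betw_bit[of n]] by simp

lemma sum_bit: "(\<Sum>j<2 ^ n :: nat. h (bit j)) = (\<Sum>b | \<forall>q\<ge>n. \<not> b q. h b)"
  by (rule sum.reindex_bij_betw[OF bij_betw_bit])

lemma bit_support: "k < 2 ^ n \<Longrightarrow> n \<le> q \<Longrightarrow> \<not> bit (k :: nat) q"
  using bij_betw_bit[of n] by (auto simp: bij_betw_def)

lemma gate_op_eq_sum:
  assumes "gate_wf n g" "i < 2 ^ n"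
  shows "gate_op g f (bit i) = (\<Sum>j<2 ^ n. gate_mat n g $$ (i, j) * f (bit j))"
proof (cases g)
  case (Single q G)
  let ?B = "{b. \<forall>q\<ge>n. \<not> b q} :: (nat \<Rightarrow> bool) set"
  let ?c = "\<lambda>v. (bit i)(q := v)"
  have sub: "{?c False, ?c True} \<subseteq> ?B"
    using assms Single bit_support[OF assms(2)] by auto
  have "(\<Sum>j<2 ^ n. gate_mat n g $$ (i, j) * f (bit j)) =
      (\<Sum>j<2 ^ n :: nat. (\<lambda>b. (if \<forall>r. r \<noteq> q \<longrightarrow> bit i r = b r
         then G $$ (of_bool (bit i q), of_bool (b q)) else 0) * f b) (bit j))"
  proof (rule sum.cong[OF refl])
    fix j :: nat assume "j \<in> {..<2 ^ n}"
    then have "j < 2 ^ n" by simp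
    then show "gate_mat n g $$ (i, j) * f (bit j) = (\<lambda>b. (if \<forall>r. r \<noteq> q \<longrightarrow> bit i r = b r
         then G $$ (of_bool (bit i q), of_bool (b q)) else 0) * f b) (bit j)"
      by (simp only: Single gate_mat.simps index_mat(1)[OF assms(2)] prod.case qbit_eq_of_bool of_bool_eq_iff)
  qed
  also have "\<dots> = (\<Sum>b\<in>?B. (if \<forall>r. r \<noteq> q \<longrightarrow> bit i r = b r
         then G $$ (of_bool (bit i q), of_bool (b q)) else 0) * f b)"
    by (rule sum_bit)
  also have "\<dots> = (\<Sum>b\<in>{?c False, ?c True}. G $$ (of_bool (bit i q), of_bool (b q)) * f b)"
  proof (rule sum.mono_neutral_cong_right[OF finite_bit_support sub])
    show "\<forall>b\<in>?B - {?c False, ?c True}. (if \<forall>r. r \<noteq> q \<longrightarrow> bit i r = b r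
         then G $$ (of_bool (bit i q), of_bool (b q)) else 0) * f b = 0"
    proof (intro ballI)
      fix b assume "b \<in> ?B - {?c False, ?c True}"
      then have "b \<noteq> ?c (b q)" by (cases "b q") auto
      moreover have "b = ?c (b q)" if "\<forall>r. r \<noteq> q \<longrightarrow> bit i r = b r"
        by (rule ext) (simp add: that)
      ultimately have "\<not> (\<forall>r. r \<noteq> q \<longrightarrow> bit i r = b r)" by blast
      then show "(if \<forall>r. r \<noteq> q \<longrightarrow> bit i r = b r
         then G $$ (of_bool (bit i q), of_bool (b q)) else 0) * f b = 0" by (simp only: if_False mult_zero_left)
    qed
  qed auto
  also have "\<dots> = G $$ (of_bool (bit i q), 0) * f (?c False) + G $$ (of_bool (bit i q), 1) * f (?c True)"
  proof -
    have "?c False \<noteq> ?c True" by (metis fun_upd_same)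
    then show ?thesis by simp
  qed
  finally show ?thesis using Single by simp
next
  case (CNOT c t)
  let ?B = "{b. \<forall>q\<ge>n. \<not> b q} :: (nat \<Rightarrow> bool) set"
  let ?F = "\<lambda>b. if b c then b(t := \<not> b t) else b"
  have ct: "c < n" "t < n" "c \<noteq> t"
    using assms CNOT by auto
  have flip: "bit (flip t j) = (bit j)(t := \<not> bit j t)" for j :: nat
    by (auto simp: flip_eq_flip_bit fun_eq_iff bit_flip_bit_iff)
  have inj: "i = j \<longleftrightarrow> bit i = bit j" for i j :: nat
    by (auto intro: bit_eqI)
  have sub: "?F (bit i) \<in> ?B"
    using ct bit_support[OF assms(2)] by auto
  \<comment> \<open>The CNOT map is an involution because \<open>c\<close> and \<open>t\<close>
    differ; solving for the column leaves a single nonzero summand.\<close>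
  have invo: "bit i = ?F b \<longleftrightarrow> b = ?F (bit i)" for b
    using ct(3) by (auto simp: fun_eq_iff)
  have "(\<Sum>j<2 ^ n. gate_mat n g $$ (i, j) * f (bit j)) =
      (\<Sum>j<2 ^ n :: nat. (\<lambda>b. of_bool (b = ?F (bit i)) * f b) (bit j))"
    unfolding invo[symmetric]
  proof (rule sum.cong[OF refl])
    fix j :: nat assume "j \<in> {..<2 ^ n}"
    then have "gate_mat n g $$ (i, j) = of_bool (i = (if bit j c then flip t j else j))"
      using assms(2) by (simp add: CNOT qbit_eq_of_bool)
    also have "i = (if bit j c then flip t j else j) \<longleftrightarrow> bit i = ?F (bit j)"
      by (cases "bit j c") (simp_all only: inj flip if_True if_False)
    finally show "gate_mat n g $$ (i, j) * f (bit j) = (\<lambda>b. of_bool (bit i = ?F b) * f b) (bit j)"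
      by simp
  qed
  also have "\<dots> = (\<Sum>b\<in>?B. of_bool (b = ?F (bit i)) * f b)"
    by (rule sum_bit)
  also have "\<dots> = (\<Sum>b\<in>{?F (bit i)}. f b)"
    by (rule sum.mono_neutral_cong_right[OF finite_bit_support]) (use sub in auto)
  finally show ?thesis using CNOT by simp
qed

lemma gate_mat_carrier: "gate_mat n g \<in> carrier_mat (2 ^ n) (2 ^ n)"
  by (cases g) auto

lemma circuit_mat_carrier: "circuit_mat n C \<in> carrier_mat (2 ^ n) (2 ^ n)"
  by (induction C) (auto intro!: mult_carrier_mat gate_mat_carrier)

lemma circuit_op_eq_sum:
  assumes "circuit_wf n C" "i < 2 ^ n"
  shows "circuit_op C f (bit i) = (\<Sum>j<2 ^ n. circuit_mat n C $$ (i, j) * f (bit j))"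
  using assms
proof (induction C arbitrary: f)
  case Nil
  then show ?case
    by (simp add: if_distrib[of "\<lambda>x. x * _"] cong: if_cong)
next
  case (Cons g C)
  then have wf: "gate_wf n g" "circuit_wf n C" by (auto simp: circuit_wf_def)
  have "circuit_op (g # C) f (bit i) = (\<Sum>l<2 ^ n. circuit_mat n C $$ (i, l) * gate_op g f (bit l))"
    using Cons wf by simp
  also have "\<dots> = (\<Sum>l<2 ^ n. \<Sum>j<2 ^ n. circuit_mat n C $$ (i, l) * gate_mat n g $$ (l, j) * f (bit j))"
    using gate_op_eq_sum[OF wf(1)] by (auto simp: sum_distrib_left mult.assoc intro!: sum.cong)
  also have "\<dots> = (\<Sum>j<2 ^ n. (\<Sum>l<2 ^ n. circuit_mat n C $$ (i, l) * gate_mat n g $$ (l, j)) * f (bit j))"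
    by (subst sum.swap) (simp add: sum_distrib_right)
  also have "\<dots> = (\<Sum>j<2 ^ n. circuit_mat n (g # C) $$ (i, j) * f (bit j))"
    using Cons.prems(2) circuit_mat_carrier[of n C] gate_mat_carrier[of n g]
    by (auto intro!: sum.cong simp: scalar_prod_def atLeast0LessThan)
  finally show ?case .
qed

text \<open>Applying the operator to the indicator of a basis state extracts one column of the
  matrix.\<close>

lemma circuit_mat_entry:
  assumes "circuit_wf n C" "i < 2 ^ n" "j < 2 ^ n"
  shows "circuit_mat n C $$ (i, j) = circuit_op C (\<lambda>b. of_bool (b = bit j)) (bit i)"
proof -
  have inj: "bit l = bit j \<longleftrightarrow> l = j" for l :: nat
    by (auto intro: bit_eqI)
  show ?thesis
    using assms by (simp add: circuit_op_eq_sum inj)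
qed

section \<open>Two-by-two unitary matrices\<close>

definition mat2 :: "complex \<Rightarrow> complex \<Rightarrow> complex \<Rightarrow> complex \<Rightarrow> complex mat" where
  "mat2 a b c d = mat 2 2 (\<lambda>(i, j). if i = 0 then (if j = 0 then a else b) else (if j = 0 then c else d))"

lemma mat2_index [simp]:
  "mat2 a b c d $$ (0, 0) = a" "mat2 a b c d $$ (0, Suc 0) = b"
  "mat2 a b c d $$ (Suc 0, 0) = c" "mat2 a b c d $$ (Suc 0, Suc 0) = d"
  "dim_row (mat2 a b c d) = 2" "dim_col (mat2 a b c d) = 2"
  by (auto simp: mat2_def)

lemma mat2_cases:
  assumes "A \<in> carrier_mat 2 2"
  obtains a b c d where "A = mat2 a b c d"
proof
  show "A = mat2 (A $$ (0, 0)) (A $$ (0, 1)) (A $$ (1, 0)) (A $$ (1, 1))"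
    using assms by (auto simp: mat2_def less_2_cases_iff)
qed

lemma mat2_eq_iff [simp]:
  "mat2 a b c d = mat2 a' b' c' d' \<longleftrightarrow> a = a' \<and> b = b' \<and> c = c' \<and> d = d'"
  by (metis mat2_index(1-4))

lemma mat2_mult [simp]:
  "mat2 a b c d * mat2 a' b' c' d' = mat2 (a * a' + b * c') (a * b' + b * d') (c * a' + d * c') (c * b' + d * d')"
proof -
  have "(\<Sum>i = 0..<2. h i) = h 0 + h 1" for h :: "nat \<Rightarrow> complex"
    by (simp add: numeral_2_eq_2)
  then show ?thesis
    by (intro eq_matI) (auto simp: less_2_cases_iff scalar_prod_def)
qed

lemma mat2_minus [simp]:
  "mat2 a b c d - mat2 a' b' c' d' = mat2 (a - a') (b - b') (c - c') (d - d')"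
  by (auto simp: less_2_cases_iff intro!: eq_matI)

lemma adj_mat2 [simp]: "adj (mat2 a b c d) = mat2 (cnj a) (cnj c) (cnj b) (cnj d)"
  by (auto simp: less_2_cases_iff adj_def intro!: eq_matI)

lemma one_mat_eq_mat2: "1\<^sub>m 2 = mat2 1 0 0 1"
  by (auto simp: less_2_cases_iff intro!: eq_matI)

lemma diag2_eq_mat2: "diag2 a b = mat2 a 0 0 b"
  by (auto simp: less_2_cases_iff diag2_def intro!: eq_matI)

lemma is_unitary_adj: "is_unitary d A \<Longrightarrow> is_unitary d (adj A)"
proof -
  assume A: "is_unitary d A"
  then have "adj (adj A) = A"
    by (auto simp: adj_def is_unitary_def intro!: eq_matI)
  moreover have "adj A \<in> carrier_mat d d"
    using A by (auto simp: adj_def is_unitary_def)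
  ultimately show ?thesis using A by (simp add: is_unitary_def)
qed

lemma is_unitary_mat2_iff:
  "is_unitary 2 (mat2 a b c d) \<longleftrightarrow>
     a * cnj a + b * cnj b = 1 \<and> a * cnj c + b * cnj d = 0 \<and>
     c * cnj a + d * cnj b = 0 \<and> c * cnj c + d * cnj d = 1 \<and>
     cnj a * a + cnj c * c = 1 \<and> cnj a * b + cnj c * d = 0 \<and>
     cnj b * a + cnj d * c = 0 \<and> cnj b * b + cnj d * d = 1"
  by (simp only: is_unitary_def one_mat_eq_mat2 adj_mat2 mat2_mult mat2_eq_iff carrier_mat_def
      mem_Collect_eq mat2_index conj_assoc simp_thms)

section \<open>Realizable operators\<close>

definition realizes :: "nat \<Rightarrow> nat \<Rightarrow> oper \<Rightarrow> bool" where
  "realizes n c T \<longleftrightarrow> (\<exists>C. circuit_wf n C \<and> cnot_count C \<le> c \<and> circuit_op C = T)"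

lemma realizes_id: "realizes n c id"
  unfolding realizes_def by (rule exI[of _ "[]"]) (auto simp: circuit_wf_def cnot_count_def)

lemma realizes_comp:
  assumes "realizes n c T" "realizes n d S" "c + d \<le> e"
  shows "realizes n e (T \<circ> S)"
proof -
  obtain C D where "circuit_wf n C" "cnot_count C \<le> c" "circuit_op C = T"
    "circuit_wf n D" "cnot_count D \<le> d" "circuit_op D = S"
    using assms unfolding realizes_def by blast
  then show ?thesis
    using assms(3) unfolding realizes_def
    by (intro exI[of _ "D @ C"]) (auto simp: circuit_wf_def cnot_count_def circuit_op_append)
qed

lemma realizes_comp_0_left: "realizes n 0 T \<Longrightarrow> realizes n d S \<Longrightarrow> realizes n d (T \<circ> S)"
  and realizes_comp_0_right: "realizes n c T \<Longrightarrow> realizes n 0 S \<Longrightarrow> realizes n c (T \<circ> S)"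
  using realizes_comp[of n 0 T d S d] realizes_comp[of n c T 0 S c] by simp_all

lemma realizes_gate:
  assumes "gate_wf n g" "case g of CNOT _ _ \<Rightarrow> 1 \<le> c | _ \<Rightarrow> True"
  shows "realizes n c (gate_op g)"
  unfolding realizes_def using assms
  by (intro exI[of _ "[g]"]) (auto simp: circuit_wf_def cnot_count_def split: gate.splits)

fun inv_gate :: "gate \<Rightarrow> gate" where
  "inv_gate (Single q G) = Single q (adj G)"
| "inv_gate (CNOT c t) = CNOT c t"

lemma gate_op_inv_gate:
  assumes "gate_wf n g"
  shows "gate_op (inv_gate g) \<circ> gate_op g = id" "gate_op g \<circ> gate_op (inv_gate g) = id"
proof -
  have "gate_op (inv_gate g) (gate_op g f) b = f b \<and> gate_op g (gate_op (inv_gate g) f) b = f b" for f b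
  proof (cases g)
    case (Single q G)
    then have "is_unitary 2 G" using assms by simp
    then obtain x y z w where G: "G = mat2 x y z w"
      by (metis mat2_cases is_unitary_def)
    note u = \<open>is_unitary 2 G\<close>[unfolded G is_unitary_mat2_iff]
    have lin: "p * (r * u + s * v) + p' * (r' * u + s' * v) = e * u + e' * v"
      if "p * r + p' * r' = e" "p * s + p' * s' = e'" for p p' r r' s s' u v e e' :: complex
      unfolding that[symmetric] by (simp add: algebra_simps)
    have "gate_op (inv_gate g) (gate_op g f) b = of_bool (\<not> b q) * f (b(q := False)) + of_bool (b q) * f (b(q := True))"
      unfolding Single G by (cases "b q"; simp only: gate_op.simps inv_gate.simps fun_upd_same fun_upd_upd adj_mat2
        of_bool_eq mat2_index not_True_eq_False not_False_eq_True One_nat_def; rule lin; use u in simp)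
    moreover have "gate_op g (gate_op (inv_gate g) f) b = of_bool (\<not> b q) * f (b(q := False)) + of_bool (b q) * f (b(q := True))"
      unfolding Single G by (cases "b q"; simp only: gate_op.simps inv_gate.simps fun_upd_same fun_upd_upd adj_mat2
        of_bool_eq mat2_index not_True_eq_False not_False_eq_True One_nat_def; rule lin; use u in simp)
    moreover have "of_bool (\<not> b q) * f (b(q := False)) + of_bool (b q) * f (b(q := True)) = f b"
      by (cases "b q") (simp_all add: fun_upd_idem)
    ultimately show ?thesis by simp
  next
    case (CNOT c t)
    then show ?thesis using assms by (auto simp: fun_upd_idem)
  qed
  then show "gate_op (inv_gate g) \<circ> gate_op g = id" "gate_op g \<circ> gate_op (inv_gate g) = id"
    by (auto simp: fun_eq_iff)
qed

lemma comp_cancel: "B \<circ> C = id \<Longrightarrow> A \<circ> D = id \<Longrightarrow> (A \<circ> B) \<circ> (C \<circ> D) = id"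
  by (simp add: fun_eq_iff)

text \<open>The inverse is the reversed circuit with every gate inverted; a CNOT is its own inverse,
  so the cost is unchanged.\<close>

lemma realizes_left_inverse:
  assumes "realizes n c T"
  obtains S where "realizes n c S" "S \<circ> T = id" "T \<circ> S = id"
proof -
  obtain C where C: "circuit_wf n C" "cnot_count C \<le> c" "circuit_op C = T"
    using assms unfolding realizes_def by blast
  let ?D = "rev (map inv_gate C)"
  have "circuit_wf n C \<Longrightarrow> circuit_op (rev (map inv_gate C)) \<circ> circuit_op C = id \<and>
      circuit_op C \<circ> circuit_op (rev (map inv_gate C)) = id" for C
  proof (induction C)
    case (Cons g C)
    then have wf: "gate_wf n g" "circuit_wf n C" by (simp_all add: circuit_wf_def)
    have rev: "circuit_op (rev (map inv_gate (g # C))) = gate_op (inv_gate g) \<circ> circuit_op (rev (map inv_gate C))"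
      by (simp add: circuit_op_append)
    note IH = conjunct1[OF Cons.IH[OF wf(2)]] conjunct2[OF Cons.IH[OF wf(2)]]
    show ?case
      unfolding rev using comp_cancel[OF IH(1) gate_op_inv_gate(1)[OF wf(1)]]
        comp_cancel[OF gate_op_inv_gate(2)[OF wf(1)] IH(2)]
      by (simp only: circuit_op.simps)
  qed simp
  moreover have "circuit_wf n ?D"
  proof -
    have "gate_wf n (inv_gate g)" if "gate_wf n g" for g
      using that by (cases g) (auto simp: is_unitary_adj)
    then show ?thesis using C(1) by (auto simp: circuit_wf_def)
  qed
  moreover have "cnot_count ?D = cnot_count C"
  proof -
    have "(case inv_gate g of CNOT _ _ \<Rightarrow> True | _ \<Rightarrow> False) = (case g of CNOT _ _ \<Rightarrow> True | _ \<Rightarrow> False)" for g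
      by (cases g) auto
    then show ?thesis by (simp add: cnot_count_def rev_filter[symmetric] filter_map comp_def)
  qed
  ultimately show ?thesis
    using C that[of "circuit_op ?D"] unfolding realizes_def by metis
qed

text \<open>Inverses are unique, so an operator known only as a left inverse is the one given by the
  reversed circuit.\<close>

lemma realizes_inverse:
  assumes "realizes n c T" "S \<circ> T = id"
  shows "realizes n c S"
proof -
  obtain S' where S': "realizes n c S'" "T \<circ> S' = id"
    using realizes_left_inverse[OF assms(1)] by blast
  have "S = S \<circ> (T \<circ> S')" using S' by simp
  also have "\<dots> = S'" using assms(2) by (metis comp_assoc id_comp)
  finally show ?thesis using S' by simp
qed

section \<open>Elementary operators\<close>

definition diag_op :: "((nat \<Rightarrow> bool) \<Rightarrow> complex) \<Rightarrow> oper" where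
  "diag_op \<phi> f b = \<phi> b * f b"

lemma diag_op_comp: "diag_op \<phi> \<circ> diag_op \<psi> = diag_op (\<lambda>b. \<phi> b * \<psi> b)"
  by (simp add: fun_eq_iff diag_op_def)

definition sgn_bit :: "bool \<Rightarrow> complex" where
  "sgn_bit v = (if v then -1 else 1)"

lemma sgn_bit_simps [simp]:
  "sgn_bit True = -1" "sgn_bit False = 1" "sgn_bit v * sgn_bit v = 1" "sgn_bit (\<not> v) = - sgn_bit v"
  by (auto simp: sgn_bit_def)

definition flip_bit_at :: "nat \<Rightarrow> (nat \<Rightarrow> bool) \<Rightarrow> nat \<Rightarrow> bool" where
  "flip_bit_at s b = b(s := \<not> b s)"

lemma flip_bit_at_simps [simp]:
  "flip_bit_at s b s = (\<not> b s)" "q \<noteq> s \<Longrightarrow> flip_bit_at s b q = b q"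
  "flip_bit_at s (flip_bit_at s b) = b"
  by (auto simp: flip_bit_at_def)

definition had :: "nat \<Rightarrow> oper" where
  "had q f b = (sgn_bit (b q) * f b + f (flip_bit_at q b)) / sqrt 2"

definition ctrl_had :: "nat \<Rightarrow> nat \<Rightarrow> oper" where
  "ctrl_had x q f b = (if b x then had q f b else f b)"

lemma realizes_single:
  assumes "q < n" "is_unitary 2 (mat2 g00 g01 g10 g11)"
    and "\<And>f b. T f b = (if b q then g11 * f b + g10 * f (flip_bit_at q b)
                          else g00 * f b + g01 * f (flip_bit_at q b))"
  shows "realizes n 0 T"
proof -
  have "T = gate_op (Single q (mat2 g00 g01 g10 g11))"
  proof (intro ext)
    fix f b
    show "T f b = gate_op (Single q (mat2 g00 g01 g10 g11)) f b"
      by (cases "b q") (simp_all add: assms(3) flip_bit_at_def fun_upd_idem)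
  qed
  then show ?thesis
    using realizes_gate[of n "Single q (mat2 g00 g01 g10 g11)" 0] assms by simp
qed

lemma sqrt2_sqrt2: "complex_of_real (sqrt 2) * complex_of_real (sqrt 2) = 2"
  by (simp flip: of_real_mult)

lemma realizes_had: "q < n \<Longrightarrow> realizes n 0 (had q)"
proof (rule realizes_single[of q _ "1 / sqrt 2" "1 / sqrt 2" "1 / sqrt 2" "- 1 / sqrt 2"])
  show "is_unitary 2 (mat2 (1 / sqrt 2) (1 / sqrt 2) (1 / sqrt 2) (- 1 / sqrt 2))"
    unfolding is_unitary_mat2_iff by (simp add: sqrt2_sqrt2)
qed (auto simp: had_def sgn_bit_def field_simps)

definition cnot :: "nat \<Rightarrow> nat \<Rightarrow> oper" where
  "cnot c t f b = f (if b c then flip_bit_at t b else b)"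

lemma realizes_cnot: "c < n \<Longrightarrow> t < n \<Longrightarrow> c \<noteq> t \<Longrightarrow> realizes n 1 (cnot c t)"
proof -
  assume "c < n" "t < n" "c \<noteq> t"
  moreover have "cnot c t = gate_op (CNOT c t)"
    by (intro ext) (simp add: cnot_def flip_bit_at_def)
  ultimately show ?thesis using realizes_gate[of n "CNOT c t" 1] by simp
qed

definition phase :: "nat \<Rightarrow> real \<Rightarrow> oper" where
  "phase q \<theta> = diag_op (\<lambda>b. if b q then cis \<theta> else 1)"

lemma realizes_diag1:
  assumes "q < n" "cmod u = 1" "cmod v = 1"
  shows "realizes n 0 (diag_op (\<lambda>b. if b q then u else v))"
proof (rule realizes_single[of q _ v 0 0 u])
  show "is_unitary 2 (mat2 v 0 0 u)"
    using assms by (simp add: is_unitary_mat2_iff complex_norm_square[symmetric] mult.commute[of "cnj _"])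
qed (use assms in \<open>auto simp: diag_op_def\<close>)

definition ctrl_phase :: "nat \<Rightarrow> nat \<Rightarrow> real \<Rightarrow> oper" where
  "ctrl_phase p q \<theta> = diag_op (\<lambda>b. if b p \<and> b q then cis \<theta> else 1)"

text \<open>For bits, \<open>2xy = x + y - (x \<oplus> y)\<close>.\<close>
lemma realizes_ctrl_phase:
  assumes "p < n" "q < n" "p \<noteq> q"
  shows "realizes n 2 (ctrl_phase p q \<theta>)"
proof -
  have "ctrl_phase p q \<theta> =
      cnot p q \<circ> (phase q (- \<theta> / 2) \<circ> (cnot p q \<circ> (phase p (\<theta> / 2) \<circ> phase q (\<theta> / 2))))"
  proof (intro ext)
    fix f b
    show "ctrl_phase p q \<theta> f b =
      (cnot p q \<circ> (phase q (- \<theta> / 2) \<circ> (cnot p q \<circ> (phase p (\<theta> / 2) \<circ> phase q (\<theta> / 2))))) f b"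
      using assms(3)
      by (cases "b p"; cases "b q")
        (simp_all add: ctrl_phase_def cnot_def phase_def diag_op_def cis_mult mult.assoc[symmetric])
  qed
  moreover have "realizes n 0 (phase p (\<theta> / 2))" "realizes n 0 (phase q (\<theta> / 2))"
    "realizes n 0 (phase q (- \<theta> / 2))"
    using assms by (simp_all add: phase_def realizes_diag1)
  ultimately show ?thesis
    using realizes_cnot[OF assms]
      realizes_comp[of n 1 "cnot p q" 1 "phase q (- \<theta> / 2) \<circ> (cnot p q \<circ> (phase p (\<theta> / 2) \<circ> phase q (\<theta> / 2)))" 2]
    by (simp add: realizes_comp_0_left realizes_comp_0_right)
qed

definition ctrl_z :: "nat \<Rightarrow> nat \<Rightarrow> oper" where
  "ctrl_z x q = diag_op (\<lambda>b. if b x then sgn_bit (b q) else 1)"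

lemma realizes_ctrl_z:
  assumes "x < n" "q < n" "x \<noteq> q"
  shows "realizes n 1 (ctrl_z x q)"
proof -
  have "had q \<circ> (cnot x q \<circ> had q) = ctrl_z x q"
  proof (intro ext)
    fix f b
    show "(had q \<circ> (cnot x q \<circ> had q)) f b = ctrl_z x q f b"
      using assms(3)
      by (cases "b x"; cases "b q")
        (simp_all add: had_def cnot_def ctrl_z_def diag_op_def add_divide_distrib diff_divide_distrib sqrt2_sqrt2)
  qed
  moreover have "realizes n 1 (had q \<circ> (cnot x q \<circ> had q))"
    using assms by (intro realizes_comp[where c = 0 and d = 1] realizes_comp[where c = 1 and d = 0]
      realizes_had realizes_cnot) auto
  ultimately show ?thesis by simp
qed

text \<open>The Hadamard matrix is the reflection with axis at angle \<open>\<pi>/8\<close>, hence conjugate to the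
  Pauli matrix \<open>Z\<close> by the rotation by \<open>\<pi>/8\<close>.\<close>
lemma realizes_ctrl_had:
  assumes "x < n" "q < n" "x \<noteq> q"
  shows "realizes n 1 (ctrl_had x q)"
proof -
  define c s where "c = complex_of_real (cos (pi / 8))" and "s = complex_of_real (sin (pi / 8))"
  have one: "c * c + s * s = 1" "s * s + c * c = 1"
    by (simp_all add: c_def s_def flip: of_real_mult of_real_add) (simp_all flip: power2_eq_square)
  have r2: "1 / complex_of_real (sqrt 2) = complex_of_real (sqrt 2 / 2)"
    by (simp add: field_simps sqrt2_sqrt2)
  \<comment> \<open>Conjugating Z by the rotation gives entries \<open>c * c - s * s\<close> and
    \<open>2 * (c * s)\<close>, up to sign; the double angle pi/4 makes both equal to 1 / sqrt
    2.\<close>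
  have "cos (pi / 8) * cos (pi / 8) - sin (pi / 8) * sin (pi / 8) = sqrt 2 / 2"
    using cos_add[of "pi / 8" "pi / 8"] by (simp add: cos_45)
  then have cc: "c * c - s * s = 1 / complex_of_real (sqrt 2)"
    by (simp only: r2 c_def s_def of_real_mult[symmetric] of_real_diff[symmetric])
  have "cos (pi / 8) * sin (pi / 8) + cos (pi / 8) * sin (pi / 8) = sqrt 2 / 2"
    using sin_add[of "pi / 8" "pi / 8"] by (simp add: sin_45)
  then have cs: "2 * (c * s) = 1 / complex_of_real (sqrt 2)"
    by (simp only: mult_2 r2 c_def s_def of_real_mult[symmetric] of_real_add[symmetric])
  define R where "R f b = c * f b + (if b q then s else - s) * f (flip_bit_at q b)" for f :: "(nat \<Rightarrow> bool) \<Rightarrow> complex" and b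
  define R' where "R' f b = c * f b + (if b q then - s else s) * f (flip_bit_at q b)" for f :: "(nat \<Rightarrow> bool) \<Rightarrow> complex" and b
  have cnj: "cnj c = c" "cnj s = s" by (simp_all add: c_def s_def)
  have "realizes n 0 R"
    by (rule realizes_single[of q _ c "- s" s c])
      (use assms one in \<open>auto simp: R_def is_unitary_mat2_iff cnj\<close>)
  moreover have "realizes n 0 R'"
    by (rule realizes_single[of q _ c s "- s" c])
      (use assms one in \<open>auto simp: R'_def is_unitary_mat2_iff cnj\<close>)
  ultimately have "realizes n 1 (R \<circ> (ctrl_z x q \<circ> R'))"
    using assms by (intro realizes_comp[where c = 0 and d = 1] realizes_comp[where c = 1 and d = 0]
      realizes_ctrl_z) auto
  moreover have "R \<circ> (ctrl_z x q \<circ> R') = ctrl_had x q"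
  proof (intro ext)
    fix f b
    have a: "c * (c * u + s * v) + - s * (c * v + - s * u) = u" for u v
    proof -
      have "c * (c * u + s * v) + - s * (c * v + - s * u) = (c * c + s * s) * u"
        by (simp add: algebra_simps)
      then show ?thesis unfolding one by simp
    qed
    have a': "c * (c * u + - s * v) + s * (c * v + s * u) = u" for u v
    proof -
      have "c * (c * u + - s * v) + s * (c * v + s * u) = (c * c + s * s) * u"
        by (simp add: algebra_simps)
      then show ?thesis unfolding one by simp
    qed
    have d: "c * (1 * (c * u + s * v)) + - s * (-1 * (c * v + - s * u)) = (1 * u + v) / sqrt 2" for u v
    proof -
      have "c * (1 * (c * u + s * v)) + - s * (-1 * (c * v + - s * u)) = (c * c - s * s) * u + 2 * (c * s) * v"
        by (simp add: algebra_simps)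
      then show ?thesis unfolding cc cs by (simp add: add_divide_distrib)
    qed
    have d': "c * (-1 * (c * u + - s * v)) + s * (1 * (c * v + s * u)) = (-1 * u + v) / sqrt 2" for u v
    proof -
      have "c * (-1 * (c * u + - s * v)) + s * (1 * (c * v + s * u)) = - ((c * c - s * s) * u) + 2 * (c * s) * v"
        by (simp add: algebra_simps)
      then show ?thesis unfolding cc cs by (simp add: diff_divide_distrib)
    qed
    show "(R \<circ> (ctrl_z x q \<circ> R')) f b = ctrl_had x q f b"
      using assms(3) a a' d d'
      by (cases "b x"; cases "b q")
        (simp_all only: o_apply R_def R'_def ctrl_had_def had_def ctrl_z_def diag_op_def flip_bit_at_simps sgn_bit_simps
           if_True if_False not_True_eq_False not_False_eq_True mult_1 simp_thms)
  qed
  ultimately show ?thesis by simp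
qed

section \<open>Multi-controlled flips with dirty ancillas\<close>

text \<open>A controlled flip up to sign: the sign appears when \<open>g\<close> holds but \<open>x\<close> does not.\<close>
definition cflip :: "nat \<Rightarrow> nat \<Rightarrow> ((nat \<Rightarrow> bool) \<Rightarrow> bool) \<Rightarrow> oper" where
  "cflip x s g f b = (if g b then (if b x then f (flip_bit_at s b) else sgn_bit (b s) * f b) else f b)"

lemma flip_bit_at_commute: "flip_bit_at p (flip_bit_at q b) = flip_bit_at q (flip_bit_at p b)"
  by (auto simp: flip_bit_at_def fun_eq_iff)

text \<open>Base case of the chains: with \<open>x\<close> set, the Hadamard gates turn Z into X;
  with \<open>x\<close> unset they are absent and the bare Z is the spurious sign.\<close>

lemma cflip_True_eq:
  assumes "x \<noteq> s"
  shows "ctrl_had x s \<circ> (diag_op (\<lambda>b. sgn_bit (b s)) \<circ> ctrl_had x s) = cflip x s (\<lambda>_. True)"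
proof (intro ext)
  fix f b
  show "(ctrl_had x s \<circ> (diag_op (\<lambda>b. sgn_bit (b s)) \<circ> ctrl_had x s)) f b = cflip x s (\<lambda>_. True) f b"
    using assms by (cases "b x"; cases "b s")
      (simp_all add: ctrl_had_def cflip_def diag_op_def had_def add_divide_distrib diff_divide_distrib sqrt2_sqrt2)
qed

text \<open>Conjugation by \<open>ctrl_z c s\<close> turns the flip of \<open>c\<close> into a flip of \<open>c\<close> with a \<open>Z\<close> on \<open>s\<close>, and
  conjugation by the Hadamard matrix turns \<open>Z\<close> into \<open>X\<close>.\<close>
lemma cflip_conjugate:
  assumes "distinct [x, s, x', c]" "\<And>b. g (flip_bit_at s b) = g b" "\<And>b. g (flip_bit_at c b) = g b"
  shows "(ctrl_had x s \<circ> ctrl_z c s) \<circ> cflip x' c g \<circ> (ctrl_z c s \<circ> ctrl_had x s)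
    = cflip x s (\<lambda>b. b x' \<and> g b) \<circ> cflip x' c g"
proof (intro ext)
  fix f b
  have ne: "x \<noteq> s" "s \<noteq> x" "x \<noteq> x'" "x' \<noteq> x" "x \<noteq> c" "c \<noteq> x" "s \<noteq> x'" "x' \<noteq> s" "s \<noteq> c" "c \<noteq> s" "x' \<noteq> c" "c \<noteq> x'"
    using assms(1) by auto
  show "((ctrl_had x s \<circ> ctrl_z c s) \<circ> cflip x' c g \<circ> (ctrl_z c s \<circ> ctrl_had x s)) f b
    = (cflip x s (\<lambda>b. b x' \<and> g b) \<circ> cflip x' c g) f b"
    by (cases "b x"; cases "b s"; cases "b x'"; cases "b c"; cases "g b")
      (simp_all add: ne ctrl_had_def ctrl_z_def cflip_def diag_op_def had_def assms(2,3) flip_bit_at_commute[of c s]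
        add_divide_distrib diff_divide_distrib sqrt2_sqrt2)
qed

lemma cflip_commute_ctrl_had:
  assumes "d \<noteq> x" "d \<noteq> s" "y \<noteq> s" "\<And>b. g (flip_bit_at s b) = g b"
  shows "cflip y d g \<circ> ctrl_had x s = ctrl_had x s \<circ> cflip y d g"
proof (intro ext)
  fix f b
  have ne: "d \<noteq> x" "x \<noteq> d" "d \<noteq> s" "s \<noteq> d" "y \<noteq> s" "s \<noteq> y" using assms by auto
  show "(cflip y d g \<circ> ctrl_had x s) f b = (ctrl_had x s \<circ> cflip y d g) f b"
    by (simp add: ne cflip_def ctrl_had_def had_def assms(4) flip_bit_at_commute[of d s] field_simps)
qed

text \<open>\<open>ctrl_z\<close> is diagonal and independent of \<open>d\<close>, the only qubit
  that the flip changes; \<open>y\<close> may therefore coincide with \<open>c\<close> or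
  \<open>s\<close>.\<close>

lemma cflip_commute_ctrl_z:
  assumes "d \<noteq> c" "d \<noteq> s"
  shows "cflip y d g \<circ> ctrl_z c s = ctrl_z c s \<circ> cflip y d g"
proof (intro ext)
  fix f b
  have ne: "d \<noteq> c" "c \<noteq> d" "d \<noteq> s" "s \<noteq> d" using assms by auto
  show "(cflip y d g \<circ> ctrl_z c s) f b = (ctrl_z c s \<circ> cflip y d g) f b"
    by (simp add: ne cflip_def ctrl_z_def diag_op_def)
qed

section \<open>Chains of controlled flips\<close>

definition all_on :: "nat set \<Rightarrow> (nat \<Rightarrow> bool) \<Rightarrow> bool" where
  "all_on X b \<longleftrightarrow> (\<forall>x\<in>X. b x)"

lemma all_on_insert: "all_on (insert x X) b \<longleftrightarrow> b x \<and> all_on X b"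
  by (auto simp: all_on_def)

lemma all_on_flip_bit_at: "s \<notin> X \<Longrightarrow> all_on X (flip_bit_at s b) = all_on X b"
  by (metis all_on_def flip_bit_at_simps(2))

text \<open>The list holds pairs of a control and a (dirty) ancilla, the last control first.\<close>
fun chain :: "(nat \<times> nat) list \<Rightarrow> oper" where
  "chain [] = id"
| "chain ((x, s) # r) = cflip x s (all_on (fst ` set r)) \<circ> chain r"

lemma comp_commute:
  assumes "A \<circ> K = K \<circ> A" "B \<circ> K = K \<circ> B"
  shows "(A \<circ> B) \<circ> K = K \<circ> (A \<circ> B)"
proof -
  have "(A \<circ> B) \<circ> K = A \<circ> (K \<circ> B)" by (simp only: comp_assoc assms(2))
  also have "\<dots> = (A \<circ> K) \<circ> B" by (simp only: comp_assoc)
  also have "\<dots> = K \<circ> (A \<circ> B)" by (simp only: assms(1) comp_assoc)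
  finally show ?thesis .
qed

text \<open>Lets the gates that conjugate a chain slip past its tail, so that only the flip of the
  ancilla \<open>c\<close> at its head is affected.\<close>

lemma chain_commute:
  assumes "s \<notin> fst ` set r" "s \<notin> snd ` set r" "x \<notin> snd ` set r" "c \<notin> snd ` set r"
  shows "chain r \<circ> (ctrl_z c s \<circ> ctrl_had x s) = (ctrl_z c s \<circ> ctrl_had x s) \<circ> chain r"
  using assms
proof (induction r)
  case (Cons p r)
  obtain y d where p: "p = (y, d)" by (cases p)
  let ?E = "cflip y d (all_on (fst ` set r))" and ?K = "ctrl_z c s \<circ> ctrl_had x s"
  have "?E \<circ> ctrl_z c s = ctrl_z c s \<circ> ?E"
    using Cons.prems p by (intro cflip_commute_ctrl_z) auto
  moreover have "?E \<circ> ctrl_had x s = ctrl_had x s \<circ> ?E"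
    using Cons.prems p by (intro cflip_commute_ctrl_had all_on_flip_bit_at) auto
  ultimately have "?E \<circ> ?K = ?K \<circ> ?E"
    by (metis comp_assoc)
  moreover have "chain r \<circ> ?K = ?K \<circ> chain r"
    using Cons.prems by (intro Cons.IH) auto
  ultimately show ?case
    unfolding p chain.simps by (rule comp_commute)
qed simp

text \<open>By \<open>cflip_conjugate\<close>, conjugating the chain of the tail by two controlled
  gates prepends one flip. Each further pair thus costs 4 CNOTs, and the first pair costs 2.\<close>

lemma realizes_chain:
  assumes "r \<noteq> []" "distinct (map fst r @ map snd r)" "\<forall>(x, s)\<in>set r. x < n \<and> s < n"
  shows "realizes n (4 * length r - 2) (chain r)"
  using assms
proof (induction r rule: list_nonempty_induct)
  case (single p)
  obtain x s where p: "p = (x, s)" by (cases p)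
  have xs: "x < n" "s < n" "x \<noteq> s" using single p by auto
  have "realizes n 0 (diag_op (\<lambda>b. sgn_bit (b s)))"
    using realizes_diag1[of s n "-1" 1] xs by (simp add: sgn_bit_def)
  then have "realizes n 2 (ctrl_had x s \<circ> (diag_op (\<lambda>b. sgn_bit (b s)) \<circ> ctrl_had x s))"
    using realizes_ctrl_had[OF xs]
      realizes_comp[of n 1 "ctrl_had x s" 1 "diag_op (\<lambda>b. sgn_bit (b s)) \<circ> ctrl_had x s" 2]
    by (simp add: realizes_comp_0_left)
  moreover have "all_on {} = (\<lambda>_. True)" by (auto simp: all_on_def)
  ultimately show ?case using cflip_True_eq[OF xs(3)] p by simp
next
  case (cons p r)
  obtain x s where p: "p = (x, s)" by (cases p)
  obtain x' c r' where r: "r = (x', c) # r'" using cons.hyps by (cases r) auto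
  have dist: "distinct [x, s, x', c]" and s: "s \<notin> fst ` set r'" "s \<notin> snd ` set r'" and c: "c \<notin> fst ` set r'"
    "c \<notin> snd ` set r'" and x: "x \<notin> snd ` set r'"
    using cons.prems p r by (auto simp: image_iff)
  have lt: "x < n" "s < n" "c < n" using cons.prems p r by auto
  let ?K = "ctrl_z c s \<circ> ctrl_had x s" and ?K' = "ctrl_had x s \<circ> ctrl_z c s"
  have "?K' \<circ> chain r \<circ> ?K = ?K' \<circ> cflip x' c (all_on (fst ` set r')) \<circ> (chain r' \<circ> ?K)"
    by (simp add: r comp_assoc)
  also have "\<dots> = (?K' \<circ> cflip x' c (all_on (fst ` set r')) \<circ> ?K) \<circ> chain r'"
    by (simp only: chain_commute[OF s x c(2)] comp_assoc)
  also have "?K' \<circ> cflip x' c (all_on (fst ` set r')) \<circ> ?K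
      = cflip x s (\<lambda>b. b x' \<and> all_on (fst ` set r') b) \<circ> cflip x' c (all_on (fst ` set r'))"
    by (rule cflip_conjugate[OF dist]) (auto simp: all_on_flip_bit_at s c)
  also have "\<dots> \<circ> chain r' = chain (p # r)"
    by (simp add: p r comp_assoc all_on_insert[abs_def])
  finally have eq: "chain (p # r) = ?K' \<circ> chain r \<circ> ?K" ..
  have K: "realizes n 2 ?K" "realizes n 2 ?K'"
    using lt dist by (auto intro!: realizes_comp[where c = 1 and d = 1] realizes_ctrl_had realizes_ctrl_z)
  have "realizes n (4 * length r - 2) (chain r)"
    using cons by auto
  from realizes_comp[OF K(2) this, of "4 * length r"] have "realizes n (4 * length r) (?K' \<circ> chain r)"
    by (simp add: r)
  from this K(1) show ?case
    unfolding eq by (rule realizes_comp) simp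
qed

text \<open>Undoing the shorter chain restores the ancillas.\<close>
lemma realizes_cflip:
  assumes "r \<noteq> []" "distinct (x # s # map fst r @ map snd r)" "x < n" "s < n" "\<forall>(x, s)\<in>set r. x < n \<and> s < n"
  shows "realizes n (8 * length r) (cflip x s (all_on (fst ` set r)))"
proof -
  have "realizes n (4 * length r - 2) (chain r)"
    using assms by (intro realizes_chain) auto
  then obtain S where S: "realizes n (4 * length r - 2) S" "chain r \<circ> S = id"
    by (rule realizes_left_inverse)
  have "realizes n (4 * length ((x, s) # r) - 2) (chain ((x, s) # r))"
    using assms by (intro realizes_chain) (auto simp: image_iff)
  \<comment> \<open>With l pairs in \<open>r\<close> the two chains cost 4 (l + 1) - 2 and 4 l -
    2.\<close>
  from realizes_comp[OF this S(1), of "8 * length r"]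
  have "realizes n (8 * length r) (chain ((x, s) # r) \<circ> S)"
    using assms(1) by (cases r) auto
  then show ?thesis using S(2) by (simp add: comp_assoc)
qed

section \<open>Multi-controlled phase layers\<close>

definition flip_range :: "nat \<Rightarrow> nat \<Rightarrow> (nat \<Rightarrow> bool) \<Rightarrow> nat \<Rightarrow> bool" where
  "flip_range p m b q = (if p \<le> q \<and> q < p + m then \<not> b q else b q)"

lemma flip_range_flip_range [simp]: "flip_range p m (flip_range p m b) = b"
  by (auto simp: flip_range_def fun_eq_iff)

section \<open>Flips of a whole register by fan-out\<close>

definition fan_map :: "nat \<Rightarrow> nat \<Rightarrow> (nat \<Rightarrow> bool) \<Rightarrow> nat \<Rightarrow> bool" where
  "fan_map p m b q = (if p < q \<and> q < p + m then b q \<noteq> b p else b q)"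

definition fan :: "nat \<Rightarrow> nat \<Rightarrow> oper" where
  "fan p m f b = f (fan_map p m b)"

lemma realizes_fan: "p + m \<le> n \<Longrightarrow> realizes n (m - 1) (fan p m)"
proof (induction m)
  case 0
  have "fan_map p 0 b = b" for b by (auto simp: fan_map_def fun_eq_iff)
  then have "fan p 0 = id" by (intro ext) (simp add: fan_def)
  then show ?case by (simp only: realizes_id)
next
  case (Suc m)
  show ?case
  proof (cases "m = 0")
    case True
    then have "fan_map p (Suc m) b = b" for b by (auto simp: fan_map_def fun_eq_iff)
    then have "fan p (Suc m) = id" by (intro ext) (simp add: fan_def)
    then show ?thesis by (simp only: realizes_id)
  next
    case False
    have "fan_map p (Suc m) b = fan_map p m (if b p then flip_bit_at (p + m) b else b)" for b
      using False by (auto simp: fan_map_def flip_bit_at_def fun_eq_iff)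
    then have "fan p (Suc m) = cnot p (p + m) \<circ> fan p m"
      by (intro ext) (simp add: fan_def cnot_def)
    moreover from Suc False realizes_cnot[of p n "p + m"]
    have "realizes n 1 (cnot p (p + m))" "realizes n (m - 1) (fan p m)"
      by auto
    then have "realizes n (Suc m - 1) (cnot p (p + m) \<circ> fan p m)"
      by (rule realizes_comp) (use False in simp)
    ultimately show ?thesis by (simp only:)
  qed
qed

definition flip_all :: "nat \<Rightarrow> nat \<Rightarrow> nat \<Rightarrow> ((nat \<Rightarrow> bool) \<Rightarrow> bool) \<Rightarrow> oper" where
  "flip_all p m x g f b =
     (if g b then (if b x then f (flip_range p m b) else sgn_bit (b p) * f b) else f b)"

text \<open>The fan spreads a flip of qubit \<open>p\<close> over the whole register, while a Z on
  \<open>p\<close> is unchanged because \<open>p\<close> is the control of every CNOT in the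
  fan.\<close>

lemma flip_all_eq_fan_conjugate:
  assumes "x < p" "m \<ge> 1" "\<And>b. g (fan_map p m b) = g b"
  shows "fan p m \<circ> cflip x p g \<circ> fan p m = flip_all p m x g"
proof (intro ext)
  fix f b
  have "fan_map p m b x = b x" "fan_map p m b p = b p" "fan_map p m (fan_map p m b) = b"
    "fan_map p m (flip_bit_at p (fan_map p m b)) = flip_range p m b"
    using assms by (auto simp: fan_map_def fun_eq_iff flip_bit_at_def flip_range_def)
  then show "(fan p m \<circ> cflip x p g \<circ> fan p m) f b = flip_all p m x g f b"
    by (simp add: fan_def cflip_def flip_all_def assms(3))
qed

lemma realizes_flip_all:
  assumes "xs \<noteq> []" "length xs = length ds" "distinct (x # xs @ ds)" "\<forall>q\<in>set (x # xs @ ds). q < p"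
    "p + m \<le> n" "m \<ge> 1"
  shows "realizes n (8 * length xs + 2 * (m - 1)) (flip_all p m x (all_on (set xs)))"
proof -
  let ?r = "zip xs ds"
  have fst: "fst ` set ?r = set xs"
    using assms(2) by (metis list.set_map map_fst_zip)
  have "realizes n (8 * length ?r) (cflip x p (all_on (fst ` set ?r)))"
  proof (rule realizes_cflip)
    show "?r \<noteq> []" using assms by (cases xs; cases ds) auto
    show "distinct (x # p # map fst ?r @ map snd ?r)"
      using assms by auto
    show "\<forall>(x, s)\<in>set ?r. x < n \<and> s < n"
    proof (intro ballI, clarify)
      fix a d assume "(a, d) \<in> set ?r"
      then have "a \<in> set xs" "d \<in> set ds" by (auto dest: set_zip_leftD set_zip_rightD)
      then have "a < p" "d < p" using assms(4) by auto
      then show "a < n \<and> d < n" using assms(5) by simp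
    qed
  qed (use assms in auto)
  then have c: "realizes n (8 * length xs) (cflip x p (all_on (set xs)))"
    using assms(2) unfolding fst by simp
  have f: "realizes n (m - 1) (fan p m)"
    using assms by (intro realizes_fan)
  have "all_on (set xs) (fan_map p m b) = all_on (set xs) b" for b
  proof -
    have "fan_map p m b q = b q" if "q \<in> set xs" for q
    proof -
      have "q < p" using assms(4) that by simp
      then show ?thesis by (simp add: fan_map_def)
    qed
    then show ?thesis by (simp add: all_on_def)
  qed
  then have "fan p m \<circ> cflip x p (all_on (set xs)) \<circ> fan p m = flip_all p m x (all_on (set xs))"
    using assms by (intro flip_all_eq_fan_conjugate) auto
  moreover have "realizes n (8 * length xs + 2 * (m - 1)) (fan p m \<circ> cflip x p (all_on (set xs)) \<circ> fan p m)"
    by (rule realizes_comp[OF realizes_comp[OF f c order.refl] f]) simp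
  ultimately show ?thesis by simp
qed

lemma realizes_diag_prod:
  assumes "p + m \<le> n" "\<And>i. cmod (u i) = 1" "\<And>i. cmod (v i) = 1"
  shows "realizes n 0 (diag_op (\<lambda>b. \<Prod>i<m. if b (p + i) then u i else v i))"
  using assms(1)
proof (induction m)
  case 0
  have "diag_op (\<lambda>b. \<Prod>i<0. if b (p + i) then u i else v i) = id"
    by (simp add: diag_op_def fun_eq_iff)
  then show ?case by (simp only: realizes_id)
next
  case (Suc m)
  have "realizes n 0 (diag_op (\<lambda>b. \<Prod>i<m. if b (p + i) then u i else v i) \<circ>
      diag_op (\<lambda>b. if b (p + m) then u m else v m))"
    using Suc assms by (intro realizes_comp_0_left realizes_diag1) auto
  then show ?case by (simp add: diag_op_comp)
qed

text \<open>\<open>\<alpha>\<close> is inverted by flipping the register, so the group commutator of the two controlled flips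
  (interleaved with \<open>A\<close> and its inverse \<open>B\<close>) is \<open>A\<^sup>-\<^sup>4\<close> when both controls hold. The sign comes from
  the spurious \<open>Z\<close> of a control that holds only partially.\<close>
lemma flip_all_commutator:
  assumes "x < p" "y < p" "m \<ge> 1"
    and "\<And>b. \<alpha> b * \<alpha> (flip_range p m b) = 1"
    and "\<And>b. g (flip_range p m b) = g b" "\<And>b. h (flip_range p m b) = h b"
  defines "A \<equiv> diag_op \<alpha>" and "B \<equiv> diag_op (\<lambda>b. \<alpha> (flip_range p m b))"
    and "P \<equiv> flip_all p m x g" and "Q \<equiv> flip_all p m y h"
  shows "(P \<circ> A \<circ> (Q \<circ> B)) \<circ> (P \<circ> A \<circ> (Q \<circ> B)) =
    diag_op (\<lambda>b. (if g b \<and> h b \<and> b x \<noteq> b y then -1 else 1) *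
       (if g b \<and> b x \<and> h b \<and> b y then \<alpha> (flip_range p m b) ^ 4 else 1))"
proof (intro ext)
  fix f b
  let ?b = "flip_range p m b"
  have r: "?b x = b x" "?b y = b y" "?b p = (\<not> b p)"
    using assms(1-3) by (auto simp: flip_range_def)
  have a: "\<alpha> b * \<alpha> ?b = 1" "\<alpha> ?b * \<alpha> b = 1"
    using assms(4)[of b] by (simp_all add: mult.commute)
  have a': "\<alpha> b * (\<alpha> ?b * w) = w" "\<alpha> ?b * (\<alpha> b * w) = w" for w
    using a by (simp_all add: mult.assoc[symmetric])
  show "((P \<circ> A \<circ> (Q \<circ> B)) \<circ> (P \<circ> A \<circ> (Q \<circ> B))) f b =
    diag_op (\<lambda>b. (if g b \<and> h b \<and> b x \<noteq> b y then -1 else 1) *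
       (if g b \<and> b x \<and> h b \<and> b y then \<alpha> (flip_range p m b) ^ 4 else 1)) f b"
    unfolding P_def Q_def A_def B_def
    by (cases "g b"; cases "h b"; cases "b x"; cases "b y"; cases "b p")
      (simp_all add: flip_all_def diag_op_def r assms(5,6) a a' power4_eq_xxxx mult.assoc)
qed

section \<open>Phase layers controlled by many qubits\<close>

definition layer :: "nat \<Rightarrow> (nat \<Rightarrow> real) \<Rightarrow> nat set \<Rightarrow> (nat \<Rightarrow> bool) \<Rightarrow> complex" where
  "layer p \<phi> I b = (\<Prod>i\<in>I. if b (p + i) then cis (\<phi> i) else 1)"

text \<open>The \<open>k\<close> controls are split into two halves, one for each flip of the
  commutator, and each half borrows its dirty ancillas from the other. The factor \<kappa> collects
  all phases that depend on the controls alone.\<close>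

lemma realizes_ctrl_layer:
  assumes "k \<ge> 4" "m \<ge> 1" "k + m \<le> n"
  obtains \<kappa> where
    "realizes n (16 * (k - 2) + 8 * (m - 1))
       (diag_op (\<lambda>b. \<kappa> b * (if all_on {..<k} b then layer k \<phi> {..<m} b else 1)))"
    "\<And>b b'. (\<And>q. q < k \<Longrightarrow> b q = b' q) \<Longrightarrow> \<kappa> b = \<kappa> b'"
proof -
  \<comment> \<open>The halves are {0..<l} and {l..<k}, headed by the controls 0 and
    \<open>l\<close>. The first flip needs l - 1 ancillas from the second half, hence 2 * l \<le> k
    + 1; the second needs k - l - 1 from the first, which k \<le> 2 * l guarantees.\<close>
  define l where "l = (k + 1) div 2"
  have l: "2 \<le> l" "l + 2 \<le> k" "2 * l \<le> k + 1" "k \<le> 2 * l" using assms(1) by (auto simp: l_def)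
  define xs ys where "xs = [1..<l]" and "ys = [l + 1..<k]"
  \<comment> \<open>The commutator quadruples these angles to plus or minus half of
    \<open>\<phi> i\<close>, a relative phase of \<open>\<phi> i\<close> between the two values of a
    digit; the common factor moves into \<kappa>.\<close>
  define \<alpha> where "\<alpha> b = (\<Prod>i<m. if b (k + i) then cis (- \<phi> i / 8) else cis (\<phi> i / 8))" for b
  have \<alpha>_flip: "\<alpha> (flip_range k m b) = (\<Prod>i<m. if b (k + i) then cis (\<phi> i / 8) else cis (- \<phi> i / 8))" for b
    unfolding \<alpha>_def by (intro prod.cong) (auto simp: flip_range_def)
  have \<alpha>1: "\<alpha> b * \<alpha> (flip_range k m b) = 1" for b
    unfolding \<alpha>_flip unfolding \<alpha>_def prod.distrib[symmetric] by (intro prod.neutral) (auto simp: cis_mult)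
  define A B P Q where "A = diag_op \<alpha>" and "B = diag_op (\<lambda>b. \<alpha> (flip_range k m b))"
    and "P = flip_all k m 0 (all_on (set xs))" and "Q = flip_all k m l (all_on (set ys))"
  define \<kappa> where "\<kappa> b = (if all_on (set xs) b \<and> all_on (set ys) b \<and> b 0 \<noteq> b l then -1 else 1) *
     (if all_on {..<k} b then \<Prod>i<m. cis (- \<phi> i / 2) else 1)" for b
  have all: "all_on (set xs) b \<and> b 0 \<and> all_on (set ys) b \<and> b l \<longleftrightarrow> all_on {..<k} b" for b
  proof -
    have "{..<k} = insert 0 (set xs) \<union> insert l (set ys)"
      using l by (auto simp: xs_def ys_def)
    then show ?thesis by (auto simp: all_on_def)
  qed
  have cis4: "cis (x / 8) ^ 4 = cis (x / 2)" for x
    using Complex.DeMoivre[of "x / 8" 4] by simp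
  have pow: "\<alpha> (flip_range k m b) ^ 4 = (\<Prod>i<m. cis (- \<phi> i / 2)) * layer k \<phi> {..<m} b" for b
    unfolding \<alpha>_flip layer_def prod_power_distrib prod.distrib[symmetric]
    by (intro prod.cong refl) (simp add: cis4 cis4[of "- _", simplified] cis_mult)
  have inv: "all_on X (flip_range k m b) = all_on X b" if "\<forall>q\<in>X. q < k" for X b
    using that by (auto simp: all_on_def flip_range_def)
  have "(P \<circ> A \<circ> (Q \<circ> B)) \<circ> (P \<circ> A \<circ> (Q \<circ> B)) =
    diag_op (\<lambda>b. (if all_on (set xs) b \<and> all_on (set ys) b \<and> b 0 \<noteq> b l then -1 else 1) *
       (if all_on (set xs) b \<and> b 0 \<and> all_on (set ys) b \<and> b l then \<alpha> (flip_range k m b) ^ 4 else 1))"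
    unfolding A_def B_def P_def Q_def
    by (rule flip_all_commutator) (use l assms \<alpha>1 in \<open>auto intro!: inv simp: xs_def ys_def\<close>)
  also have "\<dots> = diag_op (\<lambda>b. \<kappa> b * (if all_on {..<k} b then layer k \<phi> {..<m} b else 1))"
    unfolding all pow by (auto intro!: arg_cong[of _ _ diag_op] simp: \<kappa>_def)
  finally have eq: "(P \<circ> A \<circ> (Q \<circ> B)) \<circ> (P \<circ> A \<circ> (Q \<circ> B)) =
    diag_op (\<lambda>b. \<kappa> b * (if all_on {..<k} b then layer k \<phi> {..<m} b else 1))" .
  have "realizes n (8 * length xs + 2 * (m - 1)) P"
    unfolding P_def using l assms by (intro realizes_flip_all[where ds = "[l..<2 * l - 1]"]) (auto simp: xs_def)
  moreover have "realizes n (8 * length ys + 2 * (m - 1)) Q"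
    unfolding Q_def using l assms by (intro realizes_flip_all[where ds = "[0..<k - l - 1]"]) (auto simp: ys_def)
  moreover have "realizes n 0 A" "realizes n 0 B"
    unfolding A_def B_def \<alpha>_flip unfolding \<alpha>_def using assms by (auto intro: realizes_diag_prod)
  ultimately have "realizes n (8 * length xs + 2 * (m - 1) + (8 * length ys + 2 * (m - 1))) (P \<circ> A \<circ> (Q \<circ> B))"
    by (intro realizes_comp[OF _ _ order.refl] realizes_comp_0_right)
  \<comment> \<open>\<open>xs\<close> and \<open>ys\<close> have k - 2 elements together, as the
    heads 0 and \<open>l\<close> are not counted; each flip occurs twice.\<close>
  from realizes_comp[OF this this, of "16 * (k - 2) + 8 * (m - 1)"]
  have "realizes n (16 * (k - 2) + 8 * (m - 1)) ((P \<circ> A \<circ> (Q \<circ> B)) \<circ> (P \<circ> A \<circ> (Q \<circ> B)))"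
    using l by (simp add: xs_def ys_def)
  then show ?thesis
    unfolding eq
  proof (rule that)
    fix b b' :: "nat \<Rightarrow> bool" assume "\<And>q. q < k \<Longrightarrow> b q = b' q"
    then have "all_on X b = all_on X b'" if "\<forall>q\<in>X. q < k" for X
      using that by (auto simp: all_on_def)
    moreover have "b 0 = b' 0" "b l = b' l"
      using \<open>\<And>q. q < k \<Longrightarrow> b q = b' q\<close> l by auto
    ultimately show "\<kappa> b = \<kappa> b'"
      using l by (simp add: \<kappa>_def xs_def ys_def)
  qed
qed

section \<open>The controlled increment\<close>

text \<open>Qubits \<open>k, k + 1, \<dots>\<close> hold the binary digits of an integer, least significant digit first; it
  is incremented modulo \<open>2\<^sup>j\<close> if all of the qubits below \<open>k\<close> are set.\<close>
definition inc :: "nat \<Rightarrow> nat \<Rightarrow> (nat \<Rightarrow> bool) \<Rightarrow> nat \<Rightarrow> bool" where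
  "inc k j b q = (if k \<le> q \<and> q < k + j then b q \<noteq> all_on {..<q} b else b q)"

definition digits :: "nat \<Rightarrow> nat \<Rightarrow> (nat \<Rightarrow> bool) \<Rightarrow> real" where
  "digits k j b = (\<Sum>i<j. 2 ^ i * of_bool (b (k + i)))"

lemma inc_0: "inc k 0 b = b"
  by (auto simp: inc_def fun_eq_iff)

lemma inc_Suc: "inc k (Suc j) b = (if all_on {..<k + j} b then flip_bit_at (k + j) (inc k j b) else inc k j b)"
  by (auto simp: inc_def fun_eq_iff flip_bit_at_def less_Suc_eq)

lemma inc_outside: "q < k \<or> k + j \<le> q \<Longrightarrow> inc k j b q = b q"
  by (auto simp: inc_def)

lemma inc_eq_self: "\<not> all_on {..<k} b \<Longrightarrow> inc k j b = b"
  by (auto simp: inc_def fun_eq_iff all_on_def)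

lemma inc_flip_bit_at: "k + j \<le> q \<Longrightarrow> inc k j (flip_bit_at q b) = flip_bit_at q (inc k j b)"
  by (rule ext) (auto simp: inc_def flip_bit_at_def all_on_def)

lemma digits_flip_bit_at: "k + j \<le> q \<Longrightarrow> digits k j (flip_bit_at q b) = digits k j b"
  unfolding digits_def by (intro sum.cong) (auto simp: flip_bit_at_def)

lemma digits_inc:
  "all_on {..<k} b \<Longrightarrow> digits k j (inc k j b) = digits k j b + 1 - 2 ^ j * of_bool (all_on {..<k + j} b)"
proof (induction j)
  case (Suc j)
  have "digits k (Suc j) b' = digits k j b' + 2 ^ j * of_bool (b' (k + j))" for b'
    by (simp add: digits_def)
  moreover have "all_on {..<k + Suc j} b \<longleftrightarrow> b (k + j) \<and> all_on {..<k + j} b"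
    by (simp add: lessThan_Suc all_on_insert)
  ultimately show ?case
    using Suc by (cases "b (k + j)") (auto simp: inc_Suc digits_flip_bit_at inc_outside)
qed (simp add: digits_def)

lemma realizes_ctrl_phases:
  assumes "p + j \<le> n" "t < n" "t \<notin> {p..<p + j}"
  shows "realizes n (2 * j) (diag_op (\<lambda>b. if b t then layer p \<theta> {..<j} b else 1))"
  using assms
proof (induction j)
  case 0
  have "diag_op (\<lambda>b. if b t then layer p \<theta> {..<0} b else 1) = id"
    by (simp add: diag_op_def layer_def fun_eq_iff)
  then show ?case by (simp only: realizes_id)
next
  case (Suc j)
  have "realizes n (2 * Suc j) (diag_op (\<lambda>b. if b t then layer p \<theta> {..<j} b else 1) \<circ> ctrl_phase (p + j) t (\<theta> j))"
    by (rule realizes_comp[where c = "2 * j" and d = 2]) (use Suc in \<open>auto intro!: realizes_ctrl_phase\<close>)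
  moreover have "(\<lambda>b. (if b t then layer p \<theta> {..<j} b else 1) * (if b (p + j) \<and> b t then cis (\<theta> j) else 1)) =
    (\<lambda>b. if b t then layer p \<theta> {..<Suc j} b else 1)"
    by (auto simp: layer_def fun_eq_iff)
  ultimately show ?case by (simp add: ctrl_phase_def diag_op_comp)
qed

text \<open>A phase linear in the binary number factors into one phase per digit.\<close>

lemma layer_digits: "layer p (\<lambda>i. c * 2 ^ i) {..<j} b = cis (c * digits p j b)"
  by (induction j) (auto simp: layer_def digits_def cis_mult algebra_simps)

text \<open>The increment after the Fourier transform of all digits but the lowest \<open>j\<close>: a Fourier
  transformed digit only acquires a phase.\<close>
definition part_inc :: "nat \<Rightarrow> nat \<Rightarrow> ((nat \<Rightarrow> bool) \<Rightarrow> complex) \<Rightarrow> nat \<Rightarrow> oper" where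
  "part_inc k m \<kappa> j f b = \<kappa> b *
     (if all_on {..<k} b then layer k (\<lambda>i. - 2 * pi / 2 ^ Suc i) {j..<m} b else 1) * f (inc k j b)"

text \<open>One step of the Fourier transform, on digit \<open>j\<close>. Incrementing the lower
  digits changes \<omega> by the opposite of the layer's phase for this digit, up to a sign -1 when
  those digits overflow. What remains is a Z controlled by the carry, and the Hadamard gates turn it
  into the flip of digit \<open>j\<close>.\<close>

lemma part_inc_step:
  assumes "j < m" and \<kappa>: "\<And>b b'. (\<And>q. q < k \<Longrightarrow> b q = b' q) \<Longrightarrow> \<kappa> b = \<kappa> b'"
  defines "\<omega> \<equiv> \<lambda>b. if b (k + j) then cis (2 * pi / 2 ^ Suc j * digits k j b) else 1"
  shows "had (k + j) \<circ> diag_op (\<lambda>b. cnj (\<omega> b)) \<circ> part_inc k m \<kappa> j \<circ> (diag_op \<omega> \<circ> had (k + j)) =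
    part_inc k m \<kappa> (Suc j)"
proof (intro ext)
  fix f b
  let ?q = "k + j"
  define \<mu> where "\<mu> b = \<kappa> b * (if all_on {..<k} b then layer k (\<lambda>i. - 2 * pi / 2 ^ Suc i) {Suc j..<m} b else 1)" for b
  define \<sigma> where "\<sigma> b = (if all_on {..<?q} b \<and> b ?q then -1 else 1 :: complex)" for b
  have lay: "layer k \<theta> {j..<m} b = (if b ?q then cis (\<theta> j) else 1) * layer k \<theta> {Suc j..<m} b" for \<theta> b
    using assms(1) by (simp add: layer_def prod.atLeast_Suc_lessThan)
  have ak: "all_on {..<?q} b \<Longrightarrow> all_on {..<k} b" for b by (auto simp: all_on_def)
  have mid: "(diag_op (\<lambda>b. cnj (\<omega> b)) \<circ> part_inc k m \<kappa> j \<circ> diag_op \<omega>) g b = \<mu> b * \<sigma> b * g (inc k j b)" for g b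
  proof -
    have "cnj (\<omega> b) * (if all_on {..<k} b then (if b ?q then cis (- 2 * pi / 2 ^ Suc j) else 1) else 1) * \<omega> (inc k j b) = \<sigma> b"
    proof (cases "b ?q \<and> all_on {..<k} b")
      case True
      \<comment> \<open>The unit increment cancels against the layer; only the overflow
        \<open>e\<close> survives, since 2 pi / 2 ^ Suc j times 2 ^ j is pi.\<close>
      have "- (2 * pi / 2 ^ Suc j * d) + - 2 * pi / 2 ^ Suc j + 2 * pi / 2 ^ Suc j * (d + 1 - 2 ^ j * e) = - pi * e" for d e :: real
        by (simp add: field_simps)
      then have "cnj (\<omega> b) * cis (- 2 * pi / 2 ^ Suc j) * \<omega> (inc k j b) = cis (- pi * of_bool (all_on {..<?q} b))"
        using True by (simp add: \<omega>_def inc_outside digits_inc cis_cnj cis_mult)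
      moreover have "cis (- pi) = -1" by (simp add: complex_eq_iff)
      ultimately show ?thesis using True by (simp add: \<sigma>_def)
    next
      case False
      then show ?thesis
        using ak[of b] by (auto simp: \<omega>_def \<sigma>_def inc_outside inc_eq_self cis_cnj cis_mult)
    qed
    then show ?thesis
      by (simp add: diag_op_def part_inc_def \<mu>_def lay) (auto simp: mult_ac)
  qed
  \<comment> \<open>\<mu> does not read qubit \<open>?q\<close>, so it can be pulled out of the
    outer Hadamard gate.\<close>
  have \<mu>f: "\<mu> (flip_bit_at ?q b) = \<mu> b" for b
  proof -
    have "\<kappa> (flip_bit_at ?q b) = \<kappa> b" by (rule \<kappa>) simp
    moreover have "layer k \<theta> {Suc j..<m} (flip_bit_at ?q b) = layer k \<theta> {Suc j..<m} b" for \<theta>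
      unfolding layer_def by (intro prod.cong) auto
    ultimately show ?thesis by (simp add: \<mu>_def all_on_flip_bit_at)
  qed
  have "(had ?q \<circ> diag_op (\<lambda>b. cnj (\<omega> b)) \<circ> part_inc k m \<kappa> j \<circ> (diag_op \<omega> \<circ> had ?q)) f b =
      had ?q ((diag_op (\<lambda>b. cnj (\<omega> b)) \<circ> part_inc k m \<kappa> j \<circ> diag_op \<omega>) (had ?q f)) b"
    by simp
  also have "\<dots> = \<mu> b * f (inc k (Suc j) b)"
    unfolding had_def[of _ _ b] mid \<mu>f \<sigma>_def
    by (cases "b ?q"; cases "all_on {..<?q} b")
      (simp_all add: all_on_flip_bit_at inc_flip_bit_at inc_Suc had_def inc_outside
        add_divide_distrib diff_divide_distrib distrib_left right_diff_distrib sqrt2_sqrt2)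
  also have "\<dots> = part_inc k m \<kappa> (Suc j) f b"
    by (simp add: part_inc_def \<mu>_def)
  finally show "(had ?q \<circ> diag_op (\<lambda>b. cnj (\<omega> b)) \<circ> part_inc k m \<kappa> j \<circ> (diag_op \<omega> \<circ> had ?q)) f b =
    part_inc k m \<kappa> (Suc j) f b" .
qed

text \<open>Step i has i controlled phases on either side and so costs 4 i CNOTs; summing over i < j
  gives 2 j (j - 1).\<close>

lemma realizes_part_inc:
  assumes "realizes n c (part_inc k m \<kappa> 0)" "\<And>b b'. (\<And>q. q < k \<Longrightarrow> b q = b' q) \<Longrightarrow> \<kappa> b = \<kappa> b'"
    "j \<le> m" "k + m \<le> n"
  shows "realizes n (c + 2 * j * (j - 1)) (part_inc k m \<kappa> j)"
  using assms(3)
proof (induction j)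
  case (Suc j)
  define \<omega> where "\<omega> b = (if b (k + j) then cis (2 * pi / 2 ^ Suc j * digits k j b) else 1)" for b
  have lt: "k + j < n" using Suc assms(4) by auto
  have \<omega>: "realizes n (2 * j) (diag_op \<omega>)"
    using realizes_ctrl_phases[of k j n "k + j" "\<lambda>i. 2 * pi / 2 ^ Suc j * 2 ^ i"] lt
    unfolding layer_digits \<omega>_def by simp
  have "diag_op (\<lambda>b. cnj (\<omega> b)) \<circ> diag_op \<omega> = id"
    by (auto simp: fun_eq_iff diag_op_def \<omega>_def cis_cnj mult.assoc[symmetric] cis_mult)
  then have "realizes n (2 * j) (diag_op (\<lambda>b. cnj (\<omega> b)))"
    by (rule realizes_inverse[OF \<omega>])
  then have "realizes n (2 * j) (had (k + j) \<circ> diag_op (\<lambda>b. cnj (\<omega> b)))"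
    "realizes n (2 * j) (diag_op \<omega> \<circ> had (k + j))"
    using \<omega> realizes_had[OF lt] by (auto intro: realizes_comp_0_left realizes_comp_0_right)
  moreover have "realizes n (c + 2 * j * (j - 1)) (part_inc k m \<kappa> j)"
    using Suc by simp
  ultimately have "realizes n (2 * j + (c + 2 * j * (j - 1)) + 2 * j)
      (had (k + j) \<circ> diag_op (\<lambda>b. cnj (\<omega> b)) \<circ> part_inc k m \<kappa> j \<circ> (diag_op \<omega> \<circ> had (k + j)))"
    by (intro realizes_comp[OF realizes_comp[OF _ _ order.refl] _ order.refl])
  moreover have "2 * j + (c + 2 * j * (j - 1)) + 2 * j = c + 2 * Suc j * (Suc j - 1)"
    by (cases j) (auto simp: algebra_simps)
  moreover have "had (k + j) \<circ> diag_op (\<lambda>b. cnj (\<omega> b)) \<circ> part_inc k m \<kappa> j \<circ> (diag_op \<omega> \<circ> had (k + j)) =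
      part_inc k m \<kappa> (Suc j)"
    unfolding \<omega>_def by (rule part_inc_step[OF _ assms(2)]) (use Suc.prems in auto)
  ultimately show ?case by (simp only:)
qed (use assms(1) in simp)

section \<open>The phase kickback circuit\<close>

text \<open>Times \<open>2 ^ (m - 1)\<close>, this is the sum of the digits with weights \<open>1, 1, 2, 4, \<dots>, 2 ^ (m - 2)\<close>.
  These add up to \<open>2 ^ (m - 1)\<close>, and an increment without overflow changes the weighted sum by \<open>0\<close>
  or \<open>1\<close>. With the usual binary weights the phase on the all-ones state would only be approximate, and
  its error \<open>U - U R\<^sup>-\<^sup>1\<close> for the root \<open>R\<close> is not controlled by that of \<open>R\<close> in the max norm.\<close>
definition weight :: "nat \<Rightarrow> nat \<Rightarrow> (nat \<Rightarrow> bool) \<Rightarrow> real" where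
  "weight k m b = (digits k m b + of_bool (b k)) / 2 ^ m"

text \<open>The increment adds 1 to the number and toggles its lowest digit. Without overflow the
  two changes cancel if that digit was 1 and add up to 2 if it was 0; an overflow subtracts
  \<open>2 ^ m\<close>.\<close>

lemma weight_diff_inc:
  assumes "m \<ge> 1"
  shows "weight k m b - weight k m (inc k m b) =
    (if all_on {..<k + m} b then 1 else if all_on {..<k} b \<and> \<not> b k then - 1 / 2 ^ (m - 1) else 0)"
proof (cases "all_on {..<k} b")
  case True
  then have "inc k m b k = (\<not> b k)" using assms by (simp add: inc_def)
  moreover have "all_on {..<k + m} b \<Longrightarrow> b k" using assms by (simp add: all_on_def)
  moreover have "(2 :: real) ^ m = 2 * 2 ^ (m - 1)" using assms by (cases m) auto
  ultimately show ?thesis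
    using True by (auto simp: weight_def digits_inc field_simps)
next
  case False
  then have "\<not> all_on {..<k + m} b" by (auto simp: all_on_def)
  then show ?thesis using False by (simp add: inc_eq_self)
qed

lemma layer_add: "finite I \<Longrightarrow> layer p \<theta> I b * layer p \<phi> I b = layer p (\<lambda>i. \<theta> i + \<phi> i) I b"
  unfolding layer_def prod.distrib[symmetric] by (intro prod.cong) (auto simp: cis_mult)

lemma layer_weight:
  assumes "m \<ge> 1"
  shows "layer k (\<lambda>i. c * (2 ^ i + of_bool (i = 0)) / 2 ^ m) {..<m} b = cis (c * weight k m b)"
proof -
  have "layer k (\<lambda>i. c / 2 ^ m * of_bool (i = 0)) {..<m} b = (\<Prod>i<m. if i = 0 then (if b k then cis (c / 2 ^ m) else 1) else 1)"
    unfolding layer_def by (intro prod.cong) auto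
  also have "\<dots> = (if b k then cis (c / 2 ^ m) else 1)"
    using assms by (simp add: prod.delta)
  finally have 1: "layer k (\<lambda>i. c / 2 ^ m * of_bool (i = 0)) {..<m} b = (if b k then cis (c / 2 ^ m) else 1)" .
  have "layer k (\<lambda>i. c * (2 ^ i + of_bool (i = 0)) / 2 ^ m) {..<m} b =
      layer k (\<lambda>i. c / 2 ^ m * 2 ^ i) {..<m} b * layer k (\<lambda>i. c / 2 ^ m * of_bool (i = 0)) {..<m} b"
    by (subst layer_add) (simp_all add: field_simps)
  then show ?thesis
    unfolding layer_digits 1 by (auto simp: weight_def cis_mult field_simps)
qed

text \<open>The phase at rate \<open>t1\<close> applies whatever the target and is a product of
  single-qubit gates; only the difference \<open>t2 - t1\<close> has to be controlled by the
  target.\<close>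

lemma realizes_weight_phase:
  assumes "m \<ge> 1" "k + m < n"
  shows "realizes n (2 * m) (diag_op (\<lambda>b. cis ((if b (k + m) then t2 else t1) * weight k m b)))"
proof -
  have "realizes n 0 (diag_op (\<lambda>b. cis (t1 * weight k m b)))"
    unfolding layer_weight[OF assms(1), symmetric] layer_def
    using assms by (intro realizes_diag_prod) auto
  moreover have "realizes n (2 * m) (diag_op (\<lambda>b. if b (k + m) then cis ((t2 - t1) * weight k m b) else 1))"
    unfolding layer_weight[OF assms(1), symmetric]
    using assms by (intro realizes_ctrl_phases) auto
  ultimately have "realizes n (2 * m) (diag_op (\<lambda>b. cis (t1 * weight k m b)) \<circ>
      diag_op (\<lambda>b. if b (k + m) then cis ((t2 - t1) * weight k m b) else 1))"
    by (rule realizes_comp_0_left)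
  also have "diag_op (\<lambda>b. cis (t1 * weight k m b)) \<circ>
      diag_op (\<lambda>b. if b (k + m) then cis ((t2 - t1) * weight k m b) else 1) =
    diag_op (\<lambda>b. cis ((if b (k + m) then t2 else t1) * weight k m b))"
    unfolding diag_op_comp by (rule arg_cong[of _ _ diag_op]) (auto simp: fun_eq_iff cis_mult left_diff_distrib)
  finally show ?thesis .
qed

lemma realizes_kickback:
  assumes "k \<ge> 4" "m \<ge> 1" "k + m < n"
  shows "realizes n (4 * m ^ 2 + 16 * m + 32 * k - 80)
    (diag_op (\<lambda>b. cis ((if b (k + m) then t2 else t1) * (weight k m b - weight k m (inc k m b)))))"
proof -
  have "k + m \<le> n" using assms(3) by simp
  then obtain \<kappa> where
    D0: "realizes n (16 * (k - 2) + 8 * (m - 1)) (diag_op (\<lambda>b. \<kappa> b *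
       (if all_on {..<k} b then layer k (\<lambda>i. - 2 * pi / 2 ^ Suc i) {..<m} b else 1)))"
    and \<kappa>: "\<And>b b'. (\<And>q. q < k \<Longrightarrow> b q = b' q) \<Longrightarrow> \<kappa> b = \<kappa> b'"
    using realizes_ctrl_layer[OF assms(1,2), where \<phi> = "\<lambda>i. - 2 * pi / 2 ^ Suc i"] by blast
  define D where "D = part_inc k m \<kappa> m"
  define \<psi> where "\<psi> b = cis ((if b (k + m) then t2 else t1) * weight k m b)" for b
  define \<psi>' where "\<psi>' b = cis ((if b (k + m) then - t2 else - t1) * weight k m b)" for b
  define d where "d = 16 * (k - 2) + 8 * (m - 1) + 2 * m * (m - 1)"
  have "part_inc k m \<kappa> 0 = diag_op (\<lambda>b. \<kappa> b *
       (if all_on {..<k} b then layer k (\<lambda>i. - 2 * pi / 2 ^ Suc i) {..<m} b else 1))"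
    by (intro ext) (simp add: part_inc_def diag_op_def inc_0 atLeast0LessThan)
  then have D: "realizes n d D"
    unfolding D_def d_def using D0 assms by (intro realizes_part_inc \<kappa>) auto
  then obtain S where S: "realizes n d S" "D \<circ> S = id"
    by (rule realizes_left_inverse)
  \<comment> \<open>With all \<open>m\<close> digits transformed the remaining layer is empty, and
    \<open>D\<close> is the increment up to \<kappa>.\<close>
  have Df: "D f b = \<kappa> b * f (inc k m b)" for f b
    by (simp add: D_def part_inc_def layer_def)
  \<comment> \<open>Conjugation by \<open>D\<close> substitutes the increment into the diagonal;
    \<kappa> disappears because \<open>S\<close> inverts \<open>D\<close>.\<close>
  have "D \<circ> diag_op \<psi>' = diag_op (\<lambda>b. \<psi>' (inc k m b)) \<circ> D"
    by (intro ext) (simp add: Df diag_op_def)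
  then have "D \<circ> diag_op \<psi>' \<circ> S = diag_op (\<lambda>b. \<psi>' (inc k m b))"
    using S(2) by (simp only: comp_assoc comp_id)
  then have "diag_op \<psi> \<circ> (D \<circ> diag_op \<psi>' \<circ> S) = diag_op (\<lambda>b. \<psi> b * \<psi>' (inc k m b))"
    by (simp only: diag_op_comp)
  \<comment> \<open>The target qubit \<open>k + m\<close> lies above the register and is left alone
    by the increment.\<close>
  also have "(\<lambda>b. \<psi> b * \<psi>' (inc k m b)) =
      (\<lambda>b. cis ((if b (k + m) then t2 else t1) * (weight k m b - weight k m (inc k m b))))"
    by (auto simp: fun_eq_iff \<psi>_def \<psi>'_def inc_outside cis_mult right_diff_distrib)
  finally have eq: "diag_op \<psi> \<circ> (D \<circ> diag_op \<psi>' \<circ> S) =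
      diag_op (\<lambda>b. cis ((if b (k + m) then t2 else t1) * (weight k m b - weight k m (inc k m b))))" .
  have "realizes n (2 * m) (diag_op \<psi>)" "realizes n (2 * m) (diag_op \<psi>')"
    unfolding \<psi>_def \<psi>'_def using assms by (intro realizes_weight_phase; simp)+
  then have "realizes n (2 * m + (d + 2 * m + d)) (diag_op \<psi> \<circ> (D \<circ> diag_op \<psi>' \<circ> S))"
    using D S(1) by (intro realizes_comp[OF _ realizes_comp[OF realizes_comp[OF _ _ order.refl] _ order.refl] order.refl])
  moreover have "2 * m + (d + 2 * m + d) = 4 * m ^ 2 + 16 * m + 32 * k - 80"
  proof -
    obtain k' m' where "k = k' + 4" "m = Suc m'"
      using assms by (metis add.commute le_Suc_ex One_nat_def plus_1_eq_Suc)
    then show ?thesis by (simp add: d_def power2_eq_square algebra_simps)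
  qed
  ultimately show ?thesis unfolding eq by simp
qed

section \<open>Roots of unitary matrices\<close>

lemma adj_mult:
  assumes "A \<in> carrier_mat 2 2" "B \<in> carrier_mat 2 2"
  shows "adj (A * B) = adj B * adj A"
proof -
  obtain a b c d where A: "A = mat2 a b c d" using assms(1) by (rule mat2_cases)
  obtain a' b' c' d' where B: "B = mat2 a' b' c' d'" using assms(2) by (rule mat2_cases)
  show ?thesis by (simp add: A B mult.commute)
qed

lemma is_unitary_mult:
  assumes "is_unitary 2 A" "is_unitary 2 B"
  shows "is_unitary 2 (A * B)"
proof -
  have c: "A \<in> carrier_mat 2 2" "B \<in> carrier_mat 2 2" "adj A \<in> carrier_mat 2 2" "adj B \<in> carrier_mat 2 2"
    using assms is_unitary_adj[of 2] by (auto simp: is_unitary_def)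
  have "A * B * (adj B * adj A) = A * (B * adj B) * adj A"
    using c by (simp add: assoc_mult_mat[of _ 2 2 _ 2 _ 2])
  moreover have "adj B * adj A * (A * B) = adj B * (adj A * A) * B"
    using c by (simp add: assoc_mult_mat[of _ 2 2 _ 2 _ 2])
  ultimately show ?thesis
    using assms c by (simp add: is_unitary_def adj_mult)
qed

text \<open>If \<open>b\<close> is not 0, then \<open>(b, l - a)\<close> is an eigenvector for a
  root \<open>l\<close> of the characteristic polynomial. Completed to an orthonormal basis it makes
  \<open>U\<close> triangular, and a triangular unitary matrix is diagonal.\<close>

lemma unitary_diagonalization:
  assumes "is_unitary 2 U"
  obtains W u v where "is_unitary 2 W" "cmod u = 1" "cmod v = 1" "U = W * diag2 u v * adj W"
proof -
  obtain a b c d where U: "U = mat2 a b c d"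
    using assms by (metis mat2_cases is_unitary_def)
  note uU = assms[unfolded U is_unitary_mat2_iff]
  have norm1: "cmod z = 1" if "z * cnj z = 1" for z
    using that by (metis complex_norm_square norm_ge_zero of_real_eq_1_iff power2_eq_1_iff
        zero_le_one not_one_le_zero neg_0_le_iff_le)
  show ?thesis
  proof (cases "b = 0")
    case True
    have "a * cnj a = 1" using uU True by simp
    then have "c = 0" using uU True by auto
    then have "d * cnj d = 1" using uU by simp
    show ?thesis
    proof (rule that[of "1\<^sub>m 2" a d])
      show "is_unitary 2 (1\<^sub>m 2)" unfolding one_mat_eq_mat2 is_unitary_mat2_iff by simp
      show "U = 1\<^sub>m 2 * diag2 a d * adj (1\<^sub>m 2)"
        unfolding one_mat_eq_mat2 diag2_eq_mat2 U by (simp add: True \<open>c = 0\<close>)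
    qed (use norm1 \<open>a * cnj a = 1\<close> \<open>d * cnj d = 1\<close> in auto)
  next
    case False
    \<comment> \<open>The discriminant of the characteristic polynomial, so that \<open>l\<close> is
      one of its roots.\<close>
    define s where "s = csqrt ((a - d) ^ 2 + 4 * b * c)"
    define l where "l = (a + d + s) / 2"
    have "s ^ 2 = (a - d) ^ 2 + 4 * b * c" by (simp add: s_def)
    moreover have "s = 2 * l - a - d" by (simp add: l_def field_simps)
    ultimately have "4 * (l * (l - a)) = 4 * (c * b + d * (l - a))"
      by (simp add: power2_eq_square algebra_simps)
    then have ev: "c * b + d * (l - a) = l * (l - a)" by (subst (asm) mult_cancel_left) simp
    define r where "r = sqrt (cmod b ^ 2 + cmod (l - a) ^ 2)"
    have r: "r > 0" "complex_of_real r * complex_of_real r = b * cnj b + (l - a) * cnj (l - a)"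
    proof -
      have "cmod b ^ 2 + cmod (l - a) ^ 2 > 0" using False by (simp add: add_pos_nonneg)
      then show "r > 0" by (simp add: r_def)
      have "r * r = cmod b ^ 2 + cmod (l - a) ^ 2" by (simp add: r_def)
      then have "complex_of_real (r * r) = complex_of_real (cmod b ^ 2 + cmod (l - a) ^ 2)" by simp
      then show "complex_of_real r * complex_of_real r = b * cnj b + (l - a) * cnj (l - a)"
        by (simp only: of_real_mult of_real_add complex_norm_square)
    qed
    define p q where "p = b / r" and "q = (l - a) / r"
    have pq: "p * cnj p + q * cnj q = 1" "cnj p * p + cnj q * q = 1"
    proof -
      have "p * cnj p + q * cnj q = (b * cnj b + (l - a) * cnj (l - a)) / (complex_of_real r * complex_of_real r)"
        by (simp add: p_def q_def add_divide_distrib)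
      then show "p * cnj p + q * cnj q = 1" unfolding r(2)[symmetric] using r(1) by simp
      then show "cnj p * p + cnj q * q = 1" by (simp add: mult.commute)
    qed
    have ev': "a * p + b * q = l * p" "c * p + d * q = l * q"
    proof -
      show "a * p + b * q = l * p" by (simp add: p_def q_def algebra_simps diff_divide_distrib)
      have "c * p + d * q = (c * b + d * (l - a)) / r" by (simp add: p_def q_def add_divide_distrib)
      then show "c * p + d * q = l * q" unfolding ev by (simp add: q_def)
    qed
    define W where "W = mat2 p (- cnj q) q (cnj p)"
    have W: "is_unitary 2 W"
      unfolding W_def is_unitary_mat2_iff using pq by (simp add: mult.commute add.commute)
    define T where "T = adj W * (U * W)"
    have T: "is_unitary 2 T"
      unfolding T_def by (intro is_unitary_mult is_unitary_adj W assms)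
    have "T $$ (0, 0) = cnj p * (a * p + b * q) + cnj q * (c * p + d * q)"
      "T $$ (1, 0) = - q * (a * p + b * q) + p * (c * p + d * q)"
      by (simp_all add: T_def W_def U)
    \<comment> \<open>The first column of \<open>W\<close> is an eigenvector and the second is
      orthogonal to it.\<close>
    then have "T $$ (1, 0) = 0" unfolding ev' by simp
    moreover obtain x y z w where T': "T = mat2 x y z w"
      using T by (metis mat2_cases is_unitary_def)
    ultimately have z: "z = 0" by simp
    note uT = T[unfolded T' is_unitary_mat2_iff z]
    have xx: "x * cnj x = 1" using uT by (simp add: mult.commute)
    then have "y = 0" using uT by auto
    then have ww: "w * cnj w = 1" using uT by simp
    have car: "W \<in> carrier_mat 2 2" "adj W \<in> carrier_mat 2 2" "U \<in> carrier_mat 2 2"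
      using W is_unitary_adj[OF W] assms by (auto simp: is_unitary_def)
    have "W * T * adj W = (W * adj W) * U * (W * adj W)"
      unfolding T_def using car by (simp add: assoc_mult_mat[of _ 2 2 _ 2 _ 2])
    also have "\<dots> = U" using W car by (simp add: is_unitary_def)
    finally have "U = W * diag2 x w * adj W"
      by (simp add: T' z \<open>y = 0\<close> diag2_eq_mat2)
    then show ?thesis using that W norm1 xx ww by blast
  qed
qed

text \<open>Unit eigenvalues are \<open>cis\<close> of their arguments in (-pi, pi], so the choice
  in \<open>mat_root\<close> has a witness; the chosen one diagonalises \<open>U\<close> and its
  root simultaneously.\<close>

lemma mat_root_witness:
  assumes "is_unitary 2 U"
  obtains W t1 t2 where "is_unitary 2 W" "U = W * diag2 (cis t1) (cis t2) * adj W"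
    "mat_root N U = W * diag2 (cis (t1 / real N)) (cis (t2 / real N)) * adj W"
proof -
  obtain W u v where W: "is_unitary 2 W" "cmod u = 1" "cmod v = 1" "U = W * diag2 u v * adj W"
    using assms by (rule unitary_diagonalization)
  then have "u = cis (Arg u)" "v = cis (Arg v)"
    by (metis cis_Arg norm_zero sgn_eq div_by_1 of_real_1 zero_neq_one)+
  then have "\<exists>R W t1 t2. is_unitary 2 W \<and> -pi < t1 \<and> t1 \<le> pi \<and> -pi < t2 \<and> t2 \<le> pi \<and>
      U = W * diag2 (cis t1) (cis t2) * adj W \<and>
      R = W * diag2 (cis (t1 / real N)) (cis (t2 / real N)) * adj W"
    using W Arg_bounded[of u] Arg_bounded[of v] by metis
  from someI_ex[OF this] show ?thesis
    using that unfolding mat_root_def[symmetric] by blast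
qed

text \<open>Transfers the bound on the root to its inverse, which is its adjoint.\<close>

lemma max_norm_adj: "max_norm (adj A) = max_norm A"
proof -
  have "{cmod (adj A $$ (i, j)) | i j. i < dim_row (adj A) \<and> j < dim_col (adj A)} =
      {cmod (A $$ (i, j)) | i j. i < dim_row A \<and> j < dim_col A}"
    by (force simp: adj_def)
  then show ?thesis by (simp add: max_norm_def)
qed

lemma max_norm_diff_self: "max_norm (A - A) = 0"
proof -
  have "{cmod ((A - A) $$ (i, j)) | i j. i < dim_row (A - A) \<and> j < dim_col (A - A)} \<union> {0} = {0}"
    by auto
  then show ?thesis by (simp only: max_norm_def Max_singleton)
qed

section \<open>The decomposition\<close>

theorem theorem3:
  fixes U :: "complex mat" and \<epsilon> :: real and nb nc :: nat
  assumes "is_unitary 2 U"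
    and "\<epsilon> > 0"
    and "nb \<ge> 1"
    and "max_norm (mat_root (2 ^ (nb - 1)) U - 1\<^sub>m 2) \<le> \<epsilon>"
    and "nc \<ge> 1"
    and "nc + 1 \<ge> nb + 8"
  shows "\<exists>C. approx_decomposition nc U \<epsilon> C \<and>
           int (cnot_count C) \<le> 4 * (int nb - 1) ^ 2 + 32 * int (nc + 1) - 112"
proof -
  define k where "k = nc - nb"
  have k: "k \<ge> 7" "nc = k + nb" using assms(6) by (auto simp: k_def)
  define N where "N = (2 ^ (nb - 1) :: nat)"
  obtain W t1 t2 where W: "is_unitary 2 W" and U: "U = W * diag2 (cis t1) (cis t2) * adj W"
    and root: "mat_root N U = W * diag2 (cis (t1 / real N)) (cis (t2 / real N)) * adj W"
    using mat_root_witness[OF assms(1)] by metis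
  obtain p q r s where W': "W = mat2 p q r s"
    using W by (metis mat2_cases is_unitary_def)
  define \<Delta> where "\<Delta> b = weight k nb b - weight k nb (inc k nb b)" for b
  \<comment> \<open>The power \<delta> of \<open>U\<close>, taken on the eigenvalue angles.\<close>
  define V where "V \<delta> = W * diag2 (cis (t1 * \<delta>)) (cis (t2 * \<delta>)) * adj W" for \<delta>
  have "realizes (nc + 1) (4 * nb ^ 2 + 16 * nb + 32 * k - 80)
    (diag_op (\<lambda>b. cis ((if b nc then t2 else t1) * \<Delta> b)))"
    unfolding \<Delta>_def k(2) using assms(3) k by (intro realizes_kickback) auto
  then obtain C where C: "circuit_wf (nc + 1) C" "cnot_count C \<le> 4 * nb ^ 2 + 16 * nb + 32 * k - 80"
    "circuit_op C = diag_op (\<lambda>b. cis ((if b nc then t2 else t1) * \<Delta> b))"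
    unfolding realizes_def by blast
  \<comment> \<open>The phases of \<open>C\<close> live in the eigenbasis of \<open>U\<close>; the
    change of basis on the target takes only single-qubit gates.\<close>
  define D where "D = Single nc (adj W) # C @ [Single nc W]"
  have wf: "circuit_wf (nc + 1) D"
    using C(1) W is_unitary_adj[OF W] by (auto simp: D_def circuit_wf_def)
  have count: "cnot_count D = cnot_count C"
    by (simp add: D_def cnot_count_def)
  \<comment> \<open>The exponent is a function of the control string alone, which makes the circuit
    block diagonal.\<close>
  have \<Delta>_upd: "\<Delta> (b(nc := v)) = \<Delta> b" for b v
  proof -
    have "all_on {..<j} (b(nc := v)) = all_on {..<j} b" if "j \<le> nc" for j
      using that by (auto simp: all_on_def)
    then show ?thesis
      using assms(3) by (simp add: \<Delta>_def weight_diff_inc k(2))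
  qed
  have op: "circuit_op D f b = V (\<Delta> b) $$ (of_bool (b nc), 0) * f (b(nc := False)) +
      V (\<Delta> b) $$ (of_bool (b nc), 1) * f (b(nc := True))" for f b
    by (cases "b nc") (simp_all add: D_def circuit_op_append C(3) diag_op_def V_def W' diag2_eq_mat2 \<Delta>_upd algebra_simps)
  have entry: "circuit_mat (nc + 1) D $$ (i, j) =
      (if \<forall>q<nc. bit i q = bit j q then V (\<Delta> (bit i)) $$ (of_bool (bit i nc), of_bool (bit j nc)) else 0)"
    if ij: "i < 2 ^ (nc + 1)" "j < 2 ^ (nc + 1)" for i j
  proof -
    have "(bit i)(nc := v) = bit j \<longleftrightarrow> (\<forall>q<nc. bit i q = bit j q) \<and> bit j nc = v" for v
    proof
      assume "(bit i)(nc := v) = bit j"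
      then show "(\<forall>q<nc. bit i q = bit j q) \<and> bit j nc = v"
        by (metis fun_upd_apply nat_neq_iff)
    next
      assume eq: "(\<forall>q<nc. bit i q = bit j q) \<and> bit j nc = v"
      show "(bit i)(nc := v) = bit j"
      proof
        fix q
        show "((bit i)(nc := v)) q = bit j q"
          using eq bit_support[OF ij(1), of q] bit_support[OF ij(2), of q]
          by (cases q nc rule: linorder_cases) auto
      qed
    qed
    then show ?thesis
      unfolding circuit_mat_entry[OF wf ij] op by (cases "bit j nc") simp_all
  qed
  have diag: "circuit_mat (nc + 1) D $$ (i, j) = 0"
    if "i < 2 ^ (nc + 1)" "j < 2 ^ (nc + 1)" "i mod 2 ^ nc \<noteq> j mod 2 ^ nc" for i j
  proof -
    have "\<not> (\<forall>q<nc. bit i q = bit j q)"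
    proof
      assume "\<forall>q<nc. bit i q = bit j q"
      then have "take_bit nc i = take_bit nc j"
        by (auto intro!: bit_eqI simp: bit_take_bit_iff)
      then show False using that(3) by (simp add: take_bit_eq_mod)
    qed
    then show ?thesis unfolding entry[OF that(1,2)] by (simp only: if_False)
  qed
  have block: "target_block nc (circuit_mat (nc + 1) D) x = V (\<Delta> (bit x))" if x: "x < 2 ^ nc" for x
  proof -
    have bit: "bit (x + 2 ^ nc * a) = (bit x)(nc := a = 1)" "x + 2 ^ nc * a < 2 ^ (nc + 1)" if "a < 2" for a :: nat
    proof -
      have nx: "\<not> bit x nc" using bit_support[OF x] by simp
      have "x + 2 ^ nc = set_bit nc x" using nx by (simp add: set_bit_eq)
      then have "bit (x + 2 ^ nc) = (bit x)(nc := True)"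
        by (auto simp: fun_eq_iff bit_set_bit_iff)
      moreover have "bit x = (bit x)(nc := False)" using nx by (simp add: fun_upd_idem)
      ultimately show "bit (x + 2 ^ nc * a) = (bit x)(nc := a = 1)"
        using \<open>a < 2\<close> by (auto simp: less_2_cases_iff)
      show "x + 2 ^ nc * a < 2 ^ (nc + 1)" using x \<open>a < 2\<close> by (auto simp: less_2_cases_iff)
    qed
    show ?thesis
    proof (rule eq_matI)
      fix a c assume "a < dim_row (V (\<Delta> (bit x)))" "c < dim_col (V (\<Delta> (bit x)))"
      then have ac: "a < 2" "c < 2" by (simp_all add: V_def W' diag2_eq_mat2)
      have "circuit_mat (nc + 1) D $$ (x + 2 ^ nc * a, x + 2 ^ nc * c) =
          V (\<Delta> (bit x)) $$ (of_bool (a = 1), of_bool (c = 1))"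
        unfolding entry[OF bit(2)[OF ac(1)] bit(2)[OF ac(2)]] bit(1)[OF ac(1)] bit(1)[OF ac(2)]
        by (simp add: \<Delta>_upd)
      moreover have "of_bool (a = 1) = a" "of_bool (c = 1) = c" using ac by auto
      ultimately show "target_block nc (circuit_mat (nc + 1) D) x $$ (a, c) = V (\<Delta> (bit x)) $$ (a, c)"
        using ac by (simp add: target_block_def)
    qed (simp_all add: target_block_def V_def W' diag2_eq_mat2)
  qed
  have V1: "V 1 = U" by (simp add: V_def U)
  have V0: "V 0 = 1\<^sub>m 2"
    using W by (simp add: V_def W' diag2_eq_mat2 is_unitary_def)
  have VN: "max_norm (V (- 1 / 2 ^ (nb - 1)) - 1\<^sub>m 2) \<le> \<epsilon>"
  proof -
    have "V (- 1 / 2 ^ (nb - 1)) - 1\<^sub>m 2 = adj (mat_root N U - 1\<^sub>m 2)"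
      unfolding root V_def
      by (simp add: N_def W' diag2_eq_mat2 one_mat_eq_mat2 cis_cnj mult_ac)
    then show ?thesis using assms(4) by (simp add: max_norm_adj N_def)
  qed
  have norm: "max_norm (V (\<Delta> (bit x)) - (if x = 2 ^ nc - 1 then U else 1\<^sub>m 2)) \<le> \<epsilon>" if x: "x < 2 ^ nc" for x :: nat
  proof -
    have "all_on {..<nc} (bit x) \<longleftrightarrow> x = 2 ^ nc - 1"
    proof
      assume "all_on {..<nc} (bit x)"
      then have "bit x q \<longleftrightarrow> q < nc" for q
        using bit_support[OF x, of q] by (cases "q < nc") (auto simp: all_on_def)
      then have "x = mask nc"
        by (intro bit_eqI) (simp add: bit_mask_iff)
      then show "x = 2 ^ nc - 1" by (simp add: mask_eq_exp_minus_1)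
    next
      assume "x = 2 ^ nc - 1"
      then have "x = mask nc" by (simp add: mask_eq_exp_minus_1)
      then show "all_on {..<nc} (bit x)" by (simp add: all_on_def bit_mask_iff)
    qed
    \<comment> \<open>The exponent has three possible values: 1 when all controls are set, otherwise
      0 or the exponent of the inverse root.\<close>
    then show ?thesis
      unfolding \<Delta>_def weight_diff_inc[OF assms(3)] k(2)
      using V1 V0 VN assms(2) max_norm_diff_self[of U] max_norm_diff_self[of "1\<^sub>m 2"] by auto
  qed
  have "approx_decomposition nc U \<epsilon> D"
    unfolding approx_decomposition_def Let_def using wf diag block norm by auto
  moreover have "int (cnot_count D) \<le> 4 * (int nb - 1) ^ 2 + 32 * int (nc + 1) - 112"
  proof -
    have "int (cnot_count D) \<le> int (4 * nb ^ 2 + 16 * nb + 32 * k - 80)"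
      using C(2) count by simp
    also have "\<dots> = 4 * int nb ^ 2 + 16 * int nb + 32 * int k - 80"
      using k(1) by (simp add: of_nat_diff)
    \<comment> \<open>With k = nc - nb the right side exceeds the left by 8 nb + 4.\<close>
    also have "\<dots> \<le> 4 * (int nb - 1) ^ 2 + 32 * int (nc + 1) - 112"
      using k(2) assms(3) by (simp add: power2_eq_square algebra_simps)
    finally show ?thesis .
  qed
  ultimately show ?thesis by blast
qed

end
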